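(* Let $\lambda>0$, let $\alpha:[0,\infty)\to(0,1)$ be measurable, let $N=\{N(t),t\ge 0\}$ be a homogeneous Poisson process with intensity $\lambda$, and let $H=\{H(t),t\ge 0\}$ be a multistable subordinator with index function $\alpha$, independent of $N$. Let $X(t):=N(H(t))$, $t\geq 0$ (the space-multifractional Poisson process). Then: (i) $X$ is a non-homogeneous subordinator, with time-dependent Lévy measure $$\nu_t^{*}(dx)=\lambda^{\alpha(t)}\sum_{n=1}^{\infty}(-1)^{n+1}\binom{\alpha(t)}{n}\,\delta_n(dx),\qquad t\ge 0.$$ (ii) $X$ has the following transition probabilities, for $\tau,t\ge 0$ and $k\in\{0,1,2,\dots\}$: $$\Pr\{X(\tau+t)=k+n\mid X(\tau)=k\}=\begin{cases}\displaystyle\sum_{r=1}^{\infty}\frac{(-1)^{n+r}}{r!}\int_{[\tau,\tau+t]^r}\lambda^{\beta_r(s)}\binom{\beta_r(s)}{n}\,ds_1\cdots ds_r, & n\ge 1,\\[2mm] \displaystyle e^{-\int_\tau^{\tau+t}\lambda^{\alpha(s)}\,ds}, & n=0,\end{cases}$$ where $\beta_r(s):=\beta_r(s_1,\dots,s_r)=\sum_{j=1}^r\alpha(s_j)$.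
   Context: An additive process is a stochastic process with independent increments, stochastically continuous, null at the origin, with càdlàg trajectories. A non-homogeneous subordinator (without drift) is a real-valued additive process $T$ with non-decreasing sample paths, characterized by a family $\{\nu_t,t\ge 0\}$ of Lévy measures on $\mathbb{R}^+$ with $\nu_t(\{0\})=0$ and $\int_0^\infty (x\wedge 1)\,\nu_t(dx)<\infty$, such that for $u\ge 0$ $$\mathbb{E}e^{-u(T(t)-T(s))}=e^{-\int_s^t f(u,\tau)\,d\tau},\quad 0\le s\le t,\qquad f(u,t)=\int_0^\infty(1-e^{-ux})\,\nu_t(dx).$$ $\{\nu_t\}$ is called the (time-dependent) Lévy measure of $T$ and $f$ its Bernstein function. The multistable subordinator $H$ with index function $\alpha:[0,\infty)\to(0,1)$ is the non-homogeneous subordinator with Lévy measure $\nu_t(dx)=\frac{\alpha(t)x^{-\alpha(t)-1}}{\Gamma(1-\alpha(t))}dx$, $x>0$; equivalently $f(u,t)=u^{\alpha(t)}$ and $\mathbb{E}e^{-u(H(t)-H(s))}=e^{-\int_s^t u^{\alpha(\tau)}d\tau}$. $\delta_n$ is the Dirac mass at $n$, and $\binom{x}{n}=\frac{x(x-1)\cdots(x-n+1)}{n!}$ for real $x$ and integer $n\geq 0$. Conditional probabilities are understood when the conditioning event has positive probability (equivalently, as the law of the increment: $\Pr\{X(\tau+t)-X(\tau)=n\}$, by space-homogeneity of additive processes). *)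

theory Defs
  imports "HOL-Probability.Probability"
begin

text \<open>
  Stochastic processes are families indexed by the reals, of which only the times \<open>t \<ge> 0\<close> matter.
  All path properties (starting value, cadlag, monotonicity) are required of every trajectory.
\<close>

definition cadlag :: "(real \<Rightarrow> real) \<Rightarrow> bool" where
  "cadlag x \<longleftrightarrow>
     (\<forall>t\<ge>0. continuous (at_right t) x) \<and>
     (\<forall>t>0. \<exists>l. (x \<longlongrightarrow> l) (at_left t))"

definition indep_increments :: "'a measure \<Rightarrow> (real \<Rightarrow> 'a \<Rightarrow> real) \<Rightarrow> bool" where
  "indep_increments M X \<longleftrightarrow>
     (\<forall>(n::nat) (t::nat \<Rightarrow> real).
        0 \<le> t 0 \<and> (\<forall>i<n. t i < t (Suc i)) \<longrightarrow>
        prob_space.indep_vars M (\<lambda>_. borel) (\<lambda>i \<omega>. X (t (Suc i)) \<omega> - X (t i) \<omega>) {..<n})"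

definition stochastically_continuous :: "'a measure \<Rightarrow> (real \<Rightarrow> 'a \<Rightarrow> real) \<Rightarrow> bool" where
  "stochastically_continuous M X \<longleftrightarrow>
     (\<forall>t\<ge>0. \<forall>\<epsilon>>0.
        ((\<lambda>s. measure M {\<omega> \<in> space M. \<bar>X s \<omega> - X t \<omega>\<bar> > \<epsilon>}) \<longlongrightarrow> 0) (at t within {0..}))"

definition additive_process :: "'a measure \<Rightarrow> (real \<Rightarrow> 'a \<Rightarrow> real) \<Rightarrow> bool" where
  "additive_process M X \<longleftrightarrow>
     prob_space M \<and>
     (\<forall>t\<ge>0. X t \<in> borel_measurable M) \<and>
     (\<forall>\<omega>\<in>space M. X 0 \<omega> = 0) \<and>
     indep_increments M X \<and>
     stochastically_continuous M X \<and>
     (\<forall>\<omega>\<in>space M. cadlag (\<lambda>t. X t \<omega>))"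

text \<open>A measure on \<open>[0,\<infinity>)\<close> without mass at 0 is encoded as a Borel measure on the reals that
  vanishes on \<open>(-\<infinity>,0]\<close>.\<close>

definition pos_Levy_measure :: "real measure \<Rightarrow> bool" where
  "pos_Levy_measure \<mu> \<longleftrightarrow>
     sets \<mu> = sets borel \<and>
     emeasure \<mu> {..0} = 0 \<and>
     (\<integral>\<^sup>+x\<in>{0<..}. ennreal (min x 1) \<partial>\<mu>) < \<infinity>"

definition Bernstein_fun :: "(real \<Rightarrow> real measure) \<Rightarrow> real \<Rightarrow> real \<Rightarrow> real" where
  "Bernstein_fun \<nu> u t = (LINT x:{0<..}|\<nu> t. 1 - exp (- u * x))"

text \<open>The integrability in time, implicit in the formula for the Laplace transform of the
  increments, is stated because the Bochner integral of a non-integrable function is 0.\<close>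

definition nonhom_subordinator ::
  "'a measure \<Rightarrow> (real \<Rightarrow> 'a \<Rightarrow> real) \<Rightarrow> (real \<Rightarrow> real measure) \<Rightarrow> bool" where
  "nonhom_subordinator M T \<nu> \<longleftrightarrow>
     additive_process M T \<and>
     (\<forall>\<omega>\<in>space M. mono_on {0..} (\<lambda>t. T t \<omega>)) \<and>
     (\<forall>t\<ge>0. pos_Levy_measure (\<nu> t)) \<and>
     (\<forall>u\<ge>0. \<forall>s\<ge>0. \<forall>t\<ge>s.
        set_integrable lborel {s..t} (Bernstein_fun \<nu> u) \<and>
        (\<integral>\<omega>. exp (- u * (T t \<omega> - T s \<omega>)) \<partial>M) =
          exp (- (LINT \<tau>:{s..t}|lborel. Bernstein_fun \<nu> u \<tau>)))"

definition multistable_Levy :: "(real \<Rightarrow> real) \<Rightarrow> real \<Rightarrow> real measure" where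
  "multistable_Levy \<alpha> t =
     density lborel (\<lambda>x. indicator {0<..} x *
       ennreal (\<alpha> t * x powr (- \<alpha> t - 1) / Gamma (1 - \<alpha> t)))"

definition multistable_subordinator ::
  "'a measure \<Rightarrow> (real \<Rightarrow> real) \<Rightarrow> (real \<Rightarrow> 'a \<Rightarrow> real) \<Rightarrow> bool" where
  "multistable_subordinator M \<alpha> H \<longleftrightarrow> nonhom_subordinator M H (multistable_Levy \<alpha>)"

text \<open>The homogeneous Poisson process is a counting process; since its paths are monotone, the
  subtraction of natural numbers below is the true increment.\<close>

definition Poisson_process :: "'a measure \<Rightarrow> real \<Rightarrow> (real \<Rightarrow> 'a \<Rightarrow> nat) \<Rightarrow> bool" where
  "Poisson_process M lam N \<longleftrightarrow>
     additive_process M (\<lambda>t \<omega>. real (N t \<omega>)) \<and>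
     (\<forall>\<omega>\<in>space M. mono_on {0..} (\<lambda>t. N t \<omega>)) \<and>
     (\<forall>s\<ge>0. \<forall>t>s.
        distr M (count_space UNIV) (\<lambda>\<omega>. N t \<omega> - N s \<omega>) = measure_pmf (poisson_pmf (lam * (t - s))))"

definition indep_processes ::
  "'a measure \<Rightarrow> (real \<Rightarrow> 'a \<Rightarrow> real) \<Rightarrow> (real \<Rightarrow> 'a \<Rightarrow> real) \<Rightarrow> bool" where
  "indep_processes M Y Z \<longleftrightarrow>
     prob_space.indep_var M
       (PiM {0..} (\<lambda>_. borel)) (\<lambda>\<omega>. \<lambda>t\<in>{0..}. Y t \<omega>)
       (PiM {0..} (\<lambda>_. borel)) (\<lambda>\<omega>. \<lambda>t\<in>{0..}. Z t \<omega>)"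

definition subordinated :: "(real \<Rightarrow> 'a \<Rightarrow> 'b) \<Rightarrow> (real \<Rightarrow> 'a \<Rightarrow> real) \<Rightarrow> real \<Rightarrow> 'a \<Rightarrow> 'b" where
  "subordinated N H t \<omega> = N (H t \<omega>) \<omega>"

text \<open>The measure \<open>\<Sum>n\<ge>1. c n \<cdot> \<delta>\<^sub>n\<close> for nonnegative weights \<open>c\<close>, realised as a push-forward of a
  weighted counting measure; see \<open>emeasure_Dirac_series\<close>.\<close>

definition Dirac_series :: "(nat \<Rightarrow> real) \<Rightarrow> real measure" where
  "Dirac_series c = distr (density (count_space {1..}) (\<lambda>n. ennreal (c n))) borel real"

lemma emeasure_Dirac_series:
  assumes "A \<in> sets borel"
  shows "emeasure (Dirac_series c) A =
           (\<Sum>n. ennreal (c (Suc n)) * emeasure (return borel (real (Suc n))) A)"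
proof -
  have "emeasure (Dirac_series c) A =
      (\<integral>\<^sup>+n. ennreal (c n) * indicator (real -` A \<inter> {1..}) n \<partial>count_space {1..})"
    using assms by (simp add: Dirac_series_def emeasure_distr emeasure_density)
  also have "\<dots> = (\<integral>\<^sup>+n. ennreal (c n) * indicator A (real n) \<partial>count_space {1..})"
    by (intro nn_integral_cong) (auto simp: indicator_def)
  also have "\<dots> = (\<integral>\<^sup>+n. ennreal (c (Suc n)) * indicator A (real (Suc n)) \<partial>count_space UNIV)"
    by (rule nn_integral_bij_count_space[symmetric],
        rule bij_betwI[where g = "\<lambda>n. n - 1"]) auto
  also have "\<dots> = (\<Sum>n. ennreal (c (Suc n)) * indicator A (real (Suc n)))"
    by (rule nn_integral_count_space_nat)
  finally show ?thesis using assms by simp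
qed

text \<open>The weights are positive for \<open>lam > 0\<close> and \<open>0 < \<alpha> t < 1\<close>, so \<^const>\<open>ennreal\<close> truncates nothing.\<close>

definition multifractional_Levy :: "real \<Rightarrow> (real \<Rightarrow> real) \<Rightarrow> real \<Rightarrow> real measure" where
  "multifractional_Levy lam \<alpha> t =
     Dirac_series (\<lambda>n. lam powr \<alpha> t * ((-1) ^ (n + 1) * (\<alpha> t gchoose n)))"

lemma multifractional_weight_pos:
  fixes a :: real
  assumes "0 < a" "a < 1"
  shows "(-1) ^ (Suc n + 1) * (a gchoose Suc n) > 0"
proof (induction n)
  case 0
  then show ?case using assms by simp
next
  case (Suc n)
  have "(a gchoose Suc (Suc n)) = (a gchoose Suc n) * (a - real (Suc n)) / real (Suc (Suc n))"
    by (simp add: gbinomial_prod_rev field_simps)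
  then have "(-1) ^ (Suc (Suc n) + 1) * (a gchoose Suc (Suc n)) =
      ((-1) ^ (Suc n + 1) * (a gchoose Suc n)) * ((real (Suc n) - a) / real (Suc (Suc n)))"
    by (simp only: \<open>(a gchoose Suc (Suc n)) = _\<close>) (simp add: field_simps)
  moreover have "(real (Suc n) - a) / real (Suc (Suc n)) > 0"
    using assms by simp
  ultimately show ?case using Suc by (simp only: mult_pos_pos)
qed

definition \<beta> :: "(real \<Rightarrow> real) \<Rightarrow> nat \<Rightarrow> (nat \<Rightarrow> real) \<Rightarrow> real" where
  "\<beta> \<alpha> r s = (\<Sum>j\<in>{1..r}. \<alpha> (s j))"

definition transition_term ::
  "real \<Rightarrow> (real \<Rightarrow> real) \<Rightarrow> real \<Rightarrow> real \<Rightarrow> nat \<Rightarrow> nat \<Rightarrow> real" where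
  "transition_term lam \<alpha> \<tau> t n r =
     (-1) ^ (n + r) / fact r *
     (LINT s:(PiE {1..r} (\<lambda>_. {\<tau>..\<tau> + t}))|PiM {1..r} (\<lambda>_. lborel).
        lam powr \<beta> \<alpha> r s * (\<beta> \<alpha> r s gchoose n))"

end

theory Submission
  imports Defs
begin

text \<open>
  For \<open>|z| \<le> 1\<close> a Poisson variable \<open>K\<close> with mean \<open>\<lambda> h\<close> satisfies \<open>E z\<^sup>K = exp (- \<lambda> (1 - z) h)\<close>.
  Conditioning on \<open>H\<close> therefore turns the generating function of an increment of \<open>X\<close> into the Laplace
  transform of the increment of \<open>H\<close> at \<open>u = \<lambda> (1 - z)\<close>, i.e. into
  \<open>exp (- \<integral> (\<lambda> (1 - z)) powr \<alpha>(s) ds)\<close>, and it transfers the independence of the increments from \<open>H\<close>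
  to \<open>X\<close>. Taking \<open>z = exp (- u)\<close> gives the Laplace exponent, whose binomial expansion is the
  Bernstein function of the Dirac series. Expanding instead the outer exponential, each power of the
  integral into an integral over a cube, and \<open>(1 - z) powr \<beta>\<^sub>r\<close> by the binomial series, the coefficients
  of \<open>z\<^sup>n\<close> are the transition probabilities.

  Conditioning on \<open>H\<close> is legitimate because \<open>H\<close> can be approximated from the right by processes with
  countably many values, for which Fubini's theorem applies on the path space; right-continuity of \<open>N\<close>
  removes the approximation.
\<close>

section \<open>Expectations\<close>

text \<open>Evaluating a path at a time, \<open>(y, h) \<mapsto> y h\<close>, is not measurable for
  the product \<sigma>-algebra on the real functions on \<open>{0..}\<close>, so Fubini cannot be
  applied to \<open>N (H t)\<close> itself. Evaluation at a time with countably many values is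
  measurable; this obstacle dictates the detour through approximations. Increments are tested with
  arbitrary functions \<phi> on the naturals bounded by 1. Indicators then yield independence,
  powers of z the generating function, and a single limit argument serves both. For the series,
  neither \<open>lam\<close> nor the time interval is small. Convergence rests on the bound
  \<open>pochhammer r n / fact n\<close> for the binomial coefficients with upper entry between 0
  and r: its generating function is the r-th power of 1 / (1 - \<bar>z\<bar>), which the factor
  \<open>1 / fact r\<close> absorbs. The bound breaks down at \<bar>z\<bar> = 1, hence coefficients
  are compared inside the open disc.\<close>

lemma (in prob_space) expectation_indicator:
  "A \<in> events \<Longrightarrow> (\<integral>\<omega>. indicator A \<omega> \<partial>M) = prob A"
  by (simp add: sets.Int_space_eq2)

lemma indicator_INT_prod:
  "finite I \<Longrightarrow> (indicator (\<Inter>i\<in>I. A i) x :: real) = (\<Prod>i\<in>I. indicator (A i) x)"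
  by (induction rule: finite_induct) (auto simp: indicator_def)

text \<open>The truncations to values below m are finite sums of indicators, bounded by
  \<open>B\<close> and eventually equal to the integrand, so dominated convergence applies.\<close>

lemma (in prob_space) expectation_nat_sums:
  fixes D :: "'a \<Rightarrow> nat" and f :: "nat \<Rightarrow> real"
  assumes D: "D \<in> M \<rightarrow>\<^sub>M count_space UNIV" and f: "\<And>n. \<bar>f n\<bar> \<le> B"
  shows "(\<lambda>n. f n * prob {\<omega> \<in> space M. D \<omega> = n}) sums (\<integral>\<omega>. f (D \<omega>) \<partial>M)"
proof -
  note [measurable] = D
  define g where "g m \<omega> = (\<Sum>n<m. f n * indicator {\<omega> \<in> space M. D \<omega> = n} \<omega>)" for m \<omega>
  have g: "g m \<omega> = (if D \<omega> < m then f (D \<omega>) else 0)" if "\<omega> \<in> space M" for m \<omega>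
  proof -
    have "g m \<omega> = (\<Sum>n<m. if D \<omega> = n then f (D \<omega>) else 0)"
      unfolding g_def using that by (intro sum.cong) (auto split: split_indicator)
    then show ?thesis by simp
  qed
  have "(\<lambda>m. \<integral>\<omega>. g m \<omega> \<partial>M) \<longlonglongrightarrow> (\<integral>\<omega>. f (D \<omega>) \<partial>M)"
  proof (rule integral_dominated_convergence[where w="\<lambda>_. B"])
    show "AE \<omega> in M. (\<lambda>m. g m \<omega>) \<longlonglongrightarrow> f (D \<omega>)"
    proof (rule AE_I2)
      fix \<omega> assume "\<omega> \<in> space M"
      then have "eventually (\<lambda>m. g m \<omega> = f (D \<omega>)) sequentially"
        unfolding eventually_sequentially by (intro exI[of _ "Suc (D \<omega>)"]) (simp add: g)
      then show "(\<lambda>m. g m \<omega>) \<longlonglongrightarrow> f (D \<omega>)" by (rule tendsto_eventually)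
    qed
    show "AE \<omega> in M. norm (g m \<omega>) \<le> B" for m
      using f order_trans[OF abs_ge_zero f] by (intro AE_I2) (simp add: g)
    show "(\<lambda>\<omega>. g m \<omega>) \<in> borel_measurable M" for m unfolding g_def by measurable
  qed auto
  also have "(\<lambda>m. \<integral>\<omega>. g m \<omega> \<partial>M) = (\<lambda>m. \<Sum>n<m. f n * prob {\<omega> \<in> space M. D \<omega> = n})"
  proof
    fix m
    have "has_bochner_integral M (\<lambda>\<omega>. g m \<omega>) (\<Sum>n<m. f n * prob {\<omega> \<in> space M. D \<omega> = n})"
      unfolding g_def
      by (intro has_bochner_integral_sum has_bochner_integral_mult_right
            has_bochner_integral_real_indicator) (auto simp: emeasure_eq_measure)
    then show "(\<integral>\<omega>. g m \<omega> \<partial>M) = (\<Sum>n<m. f n * prob {\<omega> \<in> space M. D \<omega> = n})"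
      by (rule has_bochner_integral_integral_eq)
  qed
  finally show ?thesis by (simp add: sums_def)
qed

text \<open>Independence makes the joint law a product measure and boundedness makes
  \<open>F\<close> integrable for it, so Fubini integrates out \<open>Y\<close> with
  \<open>Z\<close> frozen. It is applied with whole paths as \<open>Y\<close> and
  \<open>Z\<close>.\<close>

lemma (in prob_space) expectation_indep_var:
  fixes F :: "'b \<times> 'b \<Rightarrow> real"
  assumes I: "indep_var S Y T Z" and F: "F \<in> borel_measurable (S \<Otimes>\<^sub>M T)"
    and B: "\<And>p. \<bar>F p\<bar> \<le> B"
  shows "(\<integral>\<omega>. F (Y \<omega>, Z \<omega>) \<partial>M) = (\<integral>\<omega>'. (\<integral>\<omega>. F (Y \<omega>, Z \<omega>') \<partial>M) \<partial>M)"
proof -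
  have Y[measurable]: "Y \<in> M \<rightarrow>\<^sub>M S" and Z[measurable]: "Z \<in> M \<rightarrow>\<^sub>M T"
    using indep_var_rv1[OF I] indep_var_rv2[OF I] by auto
  note [measurable] = F
  interpret PY: prob_space "distr M S Y" by (rule prob_space_distr) fact
  interpret PZ: prob_space "distr M T Z" by (rule prob_space_distr) fact
  interpret PP: pair_prob_space "distr M S Y" "distr M T Z" ..
  have F': "F \<in> borel_measurable (distr M S Y \<Otimes>\<^sub>M distr M T Z)"
    using F by simp
  have int: "integrable (distr M S Y \<Otimes>\<^sub>M distr M T Z) F"
    using B by (intro PP.P.integrable_const_bound[of _ B]) (auto simp: F')
  have eq: "distr M (S \<Otimes>\<^sub>M T) (\<lambda>\<omega>. (Y \<omega>, Z \<omega>)) = distr M S Y \<Otimes>\<^sub>M distr M T Z"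
    using I indep_var_distribution_eq by metis
  have "(\<integral>\<omega>. F (Y \<omega>, Z \<omega>) \<partial>M) = integral\<^sup>L (distr M (S \<Otimes>\<^sub>M T) (\<lambda>\<omega>. (Y \<omega>, Z \<omega>))) F"
    by (subst integral_distr) auto
  also have "\<dots> = (\<integral>z. (\<integral>y. F (y, z) \<partial>distr M S Y) \<partial>distr M T Z)"
    unfolding eq by (subst PP.integral_snd[where f="\<lambda>y z. F (y, z)"]) (use int in auto)
  also have "\<dots> = (\<integral>\<omega>'. (\<integral>y. F (y, Z \<omega>') \<partial>distr M S Y) \<partial>M)"
  proof (rule integral_distr)
    have "(\<lambda>z. \<integral>y. F (y, z) \<partial>distr M S Y) \<in> borel_measurable (distr M T Z)"
      by (rule PY.borel_measurable_lebesgue_integral) simp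
    then show "(\<lambda>z. \<integral>y. F (y, z) \<partial>distr M S Y) \<in> borel_measurable T" by simp
  qed fact
  also have "\<dots> = (\<integral>\<omega>'. (\<integral>\<omega>. F (Y \<omega>, Z \<omega>') \<partial>M) \<partial>M)"
  proof (rule Bochner_Integration.integral_cong[OF refl])
    fix \<omega>' assume "\<omega>' \<in> space M"
    then have "Z \<omega>' \<in> space T" by (rule measurable_space[OF Z])
    then have [measurable]: "(\<lambda>y. F (y, Z \<omega>')) \<in> borel_measurable S" by measurable
    show "(\<integral>y. F (y, Z \<omega>') \<partial>distr M S Y) = (\<integral>\<omega>. F (Y \<omega>, Z \<omega>') \<partial>M)"
      by (subst integral_distr) auto
  qed
  finally show ?thesis .
qed

section \<open>Averages under a Poisson law as functions of time\<close>

text \<open>The mean of \<phi> under the Poisson law with parameter \<open>lam * h\<close>, given by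
  its power series so that it is continuous on all reals, including h = 0, where the Poisson law
  degenerates: increments of \<open>H\<close> may vanish.\<close>

definition poisson_mean :: "real \<Rightarrow> (nat \<Rightarrow> real) \<Rightarrow> real \<Rightarrow> real" where
  "poisson_mean lam \<phi> h = exp (- (lam * h)) * (\<Sum>k. \<phi> k / fact k * (lam * h) ^ k)"

lemma summable_bounded_exp_series:
  fixes \<phi> :: "nat \<Rightarrow> real"
  assumes "\<And>k. \<bar>\<phi> k\<bar> \<le> 1"
  shows "summable (\<lambda>k. \<phi> k / fact k * x ^ k)"
    and "\<bar>\<Sum>k. \<phi> k / fact k * x ^ k\<bar> \<le> exp \<bar>x\<bar>"
proof -
  have le: "norm (\<phi> k / fact k * x ^ k) \<le> \<bar>x\<bar> ^ k /\<^sub>R fact k" for k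
    using mult_right_mono[OF assms[of k], of "\<bar>x\<bar>^k / fact k"]
    by (simp add: abs_mult power_abs field_simps)
  have s: "(\<lambda>k. \<bar>x\<bar> ^ k /\<^sub>R fact k) sums exp \<bar>x\<bar>" by (rule exp_converges)
  show "summable (\<lambda>k. \<phi> k / fact k * x ^ k)"
    by (rule summable_comparison_test'[OF sums_summable[OF s] le])
  show "\<bar>\<Sum>k. \<phi> k / fact k * x ^ k\<bar> \<le> exp \<bar>x\<bar>"
    using norm_suminf_le[OF le sums_summable[OF s]] sums_unique[OF s] by simp
qed

lemma isCont_poisson_mean:
  assumes "\<And>k. \<bar>\<phi> k\<bar> \<le> 1"
  shows "isCont (poisson_mean lam \<phi>) h"
proof -
  have "isCont (\<lambda>x. \<Sum>k. \<phi> k / fact k * x ^ k) (lam * h)"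
    by (rule isCont_powser_converges_everywhere) (rule summable_bounded_exp_series[OF assms])
  then have "isCont (\<lambda>h. \<Sum>k. \<phi> k / fact k * (lam * h) ^ k) h"
    by (rule isCont_o2[rotated]) (intro continuous_intros)
  then show ?thesis unfolding poisson_mean_def[abs_def] by (intro continuous_intros)
qed

lemma borel_measurable_poisson_mean:
  assumes "\<And>k. \<bar>\<phi> k\<bar> \<le> 1"
  shows "poisson_mean lam \<phi> \<in> borel_measurable borel"
  by (intro borel_measurable_continuous_onI continuous_at_imp_continuous_on ballI
        isCont_poisson_mean assms)

text \<open>The prefactor cancels the exponential bound on the series because \<open>lam * h\<close>
  is nonnegative. The constant 1 later serves as the dominating function.\<close>

lemma abs_poisson_mean_le:
  assumes "\<And>k. \<bar>\<phi> k\<bar> \<le> 1" "0 \<le> lam * h"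
  shows "\<bar>poisson_mean lam \<phi> h\<bar> \<le> 1"
proof -
  have "\<bar>poisson_mean lam \<phi> h\<bar> \<le> exp (- (lam * h)) * exp \<bar>lam * h\<bar>"
    unfolding poisson_mean_def abs_mult[of "exp _"]
    by (rule mult_mono[OF _ summable_bounded_exp_series(2)[of \<phi>, OF assms(1)]]) auto
  then show ?thesis using assms(2) by (simp add: exp_minus)
qed

lemma poisson_mean_power: "poisson_mean lam (\<lambda>k. z ^ k) h = exp (- (lam * (1 - z)) * h)"
proof -
  have "(\<lambda>k. (z * (lam * h)) ^ k /\<^sub>R fact k) sums exp (z * (lam * h))" by (rule exp_converges)
  then have "(\<Sum>k. z ^ k / fact k * (lam * h) ^ k) = exp (z * (lam * h))"
    by (simp add: sums_iff power_mult_distrib divide_simps mult_ac)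
  then show ?thesis by (simp add: poisson_mean_def exp_add[symmetric] algebra_simps)
qed

section \<open>Randomising the time of a Poisson process\<close>

lemma nonneg_of_increasing:
  fixes t :: "nat \<Rightarrow> real"
  assumes "0 \<le> t 0" and t: "\<And>i. i < n \<Longrightarrow> t i < t (Suc i)" and "i \<le> n"
  shows "0 \<le> t i"
  using \<open>i \<le> n\<close>
proof (induction i)
  case (Suc i)
  then show ?case using t[of i] by simp
qed (use assms(1) in simp)

text \<open>Covers every non-decreasing additive time change; the law of \<open>H\<close> is fixed
  only in \<open>multifractional_poisson\<close>.\<close>

locale poisson_subordination = prob_space M for M :: "'a measure" +
  fixes N :: "real \<Rightarrow> 'a \<Rightarrow> nat" and H :: "real \<Rightarrow> 'a \<Rightarrow> real" and lam :: real
  assumes lam_pos: "0 < lam"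
    and Poisson: "Poisson_process M lam N"
    and H_additive: "additive_process M H"
    and H_mono: "\<And>\<omega>. \<omega> \<in> space M \<Longrightarrow> mono_on {0..} (\<lambda>t. H t \<omega>)"
    and indep: "indep_processes M (\<lambda>t \<omega>. real (N t \<omega>)) H"
begin

abbreviation X :: "real \<Rightarrow> 'a \<Rightarrow> nat" where "X \<equiv> subordinated N H"

lemma N_additive: "additive_process M (\<lambda>t \<omega>. real (N t \<omega>))"
  using Poisson by (simp add: Poisson_process_def)

lemma N_mono: "\<omega> \<in> space M \<Longrightarrow> 0 \<le> s \<Longrightarrow> s \<le> t \<Longrightarrow> N s \<omega> \<le> N t \<omega>"
  using Poisson by (auto simp: Poisson_process_def monotone_on_def)

lemma N_0: "\<omega> \<in> space M \<Longrightarrow> N 0 \<omega> = 0"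
  using N_additive by (auto simp: additive_process_def)

lemma measurable_N[measurable]:
  assumes "0 \<le> t" shows "N t \<in> M \<rightarrow>\<^sub>M count_space UNIV"
proof -
  have "(\<lambda>\<omega>. real (N t \<omega>)) \<in> borel_measurable M"
    using N_additive assms by (simp add: additive_process_def)
  \<comment> \<open>The values are naturals stored as reals; the map
    \<open>nat \<lfloor>x\<rfloor>\<close> recovers them measurably. The same decoding is used below
    for increments.\<close>
  then have "(\<lambda>\<omega>. nat \<lfloor>real (N t \<omega>)\<rfloor>) \<in> M \<rightarrow>\<^sub>M count_space UNIV" by measurable
  then show ?thesis by simp
qed

lemma measurable_H[measurable]: "0 \<le> t \<Longrightarrow> H t \<in> borel_measurable M"
  using H_additive by (simp add: additive_process_def)

lemma H_le: "\<omega> \<in> space M \<Longrightarrow> 0 \<le> s \<Longrightarrow> s \<le> t \<Longrightarrow> H s \<omega> \<le> H t \<omega>"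
  using H_mono[of \<omega>] by (auto simp: monotone_on_def)

lemma H_0: "\<omega> \<in> space M \<Longrightarrow> H 0 \<omega> = 0"
  using H_additive by (auto simp: additive_process_def)

lemma H_nonneg: "\<omega> \<in> space M \<Longrightarrow> 0 \<le> t \<Longrightarrow> 0 \<le> H t \<omega>"
  using H_le[of \<omega> 0 t] H_0[of \<omega>] by simp

lemma expectation_N_increment:
  assumes "0 \<le> s" "s < t" and \<phi>: "\<And>k. \<bar>\<phi> k\<bar> \<le> 1"
  shows "(\<integral>\<omega>. \<phi> (N t \<omega> - N s \<omega>) \<partial>M) = poisson_mean lam \<phi> (t - s)"
proof -
  let ?D = "\<lambda>\<omega>. N t \<omega> - N s \<omega>" and ?r = "lam * (t - s)"
  have r: "0 < ?r" using assms lam_pos by simp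
  have [measurable]: "N s \<in> M \<rightarrow>\<^sub>M count_space UNIV" "N t \<in> M \<rightarrow>\<^sub>M count_space UNIV"
    using assms by (auto intro: measurable_N)
  have D[measurable]: "?D \<in> M \<rightarrow>\<^sub>M count_space UNIV" by measurable
  have "distr M (count_space UNIV) ?D = measure_pmf (poisson_pmf ?r)"
    using Poisson assms by (simp add: Poisson_process_def)
  then have "pmf (poisson_pmf ?r) n = measure (distr M (count_space UNIV) ?D) {n}" for n
    by (simp add: pmf.rep_eq)
  then have p: "prob {\<omega> \<in> space M. ?D \<omega> = n} = pmf (poisson_pmf ?r) n" for n
    by (subst (asm) measure_distr) (auto simp: vimage_def Int_def conj_commute)
  have "(\<lambda>n. \<phi> n * pmf (poisson_pmf ?r) n) sums (\<integral>\<omega>. \<phi> (?D \<omega>) \<partial>M)"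
    using expectation_nat_sums[OF D \<phi>] unfolding p .
  moreover have "(\<lambda>n. exp (- ?r) * (\<phi> n / fact n * ?r ^ n)) sums poisson_mean lam \<phi> (t - s)"
    unfolding poisson_mean_def
    by (intro sums_mult summable_sums summable_bounded_exp_series \<phi>)
  ultimately show ?thesis
    by (simp add: pmf_poisson[OF r] sums_iff mult_ac)
qed

lemma expectation_prod_N_increments:
  assumes g0: "0 \<le> g 0" and g: "\<And>i. i < n \<Longrightarrow> g i < g (Suc i)"
    and \<phi>: "\<And>i k. \<bar>\<phi> i k\<bar> \<le> 1"
  shows "(\<integral>\<omega>. (\<Prod>i<n. \<phi> i (N (g (Suc i)) \<omega> - N (g i) \<omega>)) \<partial>M) =
    (\<Prod>i<n. poisson_mean lam (\<phi> i) (g (Suc i) - g i))"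
proof -
  have gnn: "0 \<le> g i" if "i \<le> n" for i
    using g0 g that by (rule nonneg_of_increasing)
  let ?D = "\<lambda>i \<omega>. N (g (Suc i)) \<omega> - N (g i) \<omega>"
    and ?R = "\<lambda>i \<omega>. real (N (g (Suc i)) \<omega>) - real (N (g i) \<omega>)"
  have D[measurable]: "?D i \<in> M \<rightarrow>\<^sub>M count_space UNIV" if "i < n" for i
  proof -
    have [measurable]: "N (g i) \<in> M \<rightarrow>\<^sub>M count_space UNIV" "N (g (Suc i)) \<in> M \<rightarrow>\<^sub>M count_space UNIV"
      using gnn[of i] gnn[of "Suc i"] that by (auto intro: measurable_N)
    show ?thesis by measurable
  qed
  have "indep_vars (\<lambda>_. borel) (\<lambda>i \<omega>. real (N (g (Suc i)) \<omega>) - real (N (g i) \<omega>)) {..<n}"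
    using N_additive g0 g by (simp add: additive_process_def indep_increments_def)
  then have I: "indep_vars (\<lambda>_. borel) (\<lambda>i \<omega>. \<phi> i (nat \<lfloor>?R i \<omega>\<rfloor>)) {..<n}"
    by (rule indep_vars_compose2[where Y="\<lambda>i x. \<phi> i (nat \<lfloor>x\<rfloor>)"]) measurable
  \<comment> \<open>Independence is available for differences of reals, the claim concerns
    subtraction of naturals; monotone paths reconcile the two.\<close>
  have R: "\<phi> i (?D i \<omega>) = \<phi> i (nat \<lfloor>?R i \<omega>\<rfloor>)" if "i \<in> {..<n}" "\<omega> \<in> space M" for i \<omega>
  proof -
    have "N (g i) \<omega> \<le> N (g (Suc i)) \<omega>"
      using that gnn[of i] g[of i] by (intro N_mono) auto
    then have "?R i \<omega> = real (?D i \<omega>)" by simp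
    then show ?thesis by (simp only: floor_of_nat nat_int)
  qed
  have "(\<integral>\<omega>. (\<Prod>i<n. \<phi> i (?D i \<omega>)) \<partial>M) = (\<integral>\<omega>. (\<Prod>i<n. \<phi> i (nat \<lfloor>?R i \<omega>\<rfloor>)) \<partial>M)"
    by (intro Bochner_Integration.integral_cong refl prod.cong R) auto
  also have "\<dots> = (\<Prod>i<n. \<integral>\<omega>. \<phi> i (nat \<lfloor>?R i \<omega>\<rfloor>) \<partial>M)"
  proof (rule indep_vars_lebesgue_integral[OF _ I])
    fix i assume i: "i \<in> {..<n}"
    then have "(\<lambda>\<omega>. \<phi> i (?D i \<omega>)) \<in> borel_measurable M"
      using D by (auto intro: measurable_compose)
    then have "integrable M (\<lambda>\<omega>. \<phi> i (?D i \<omega>))"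
      using \<phi> by (intro integrable_const_bound[of _ 1]) auto
    moreover have "integrable M (\<lambda>\<omega>. \<phi> i (?D i \<omega>)) \<longleftrightarrow> integrable M (\<lambda>\<omega>. \<phi> i (nat \<lfloor>?R i \<omega>\<rfloor>))"
      by (intro Bochner_Integration.integrable_cong refl R i)
    ultimately show "integrable M (\<lambda>\<omega>. \<phi> i (nat \<lfloor>?R i \<omega>\<rfloor>))" by blast
  qed simp
  also have "\<dots> = (\<Prod>i<n. \<integral>\<omega>. \<phi> i (?D i \<omega>) \<partial>M)"
    by (intro Bochner_Integration.integral_cong refl prod.cong R[symmetric]) auto
  also have "\<dots> = (\<Prod>i<n. poisson_mean lam (\<phi> i) (g (Suc i) - g i))"
    using gnn g \<phi> by (intro prod.cong expectation_N_increment) auto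
  finally show ?thesis .
qed

end

text \<open>A grid point just to the right of \<open>h\<close>. The shift by \<open>i\<close> makes the points strictly increasing
  in \<open>i\<close> even along a weakly increasing sequence of values of \<open>h\<close>.\<close>

definition grid :: "nat \<Rightarrow> nat \<Rightarrow> real \<Rightarrow> real" where
  "grid m i h = real (nat \<lfloor>real (Suc m) * h\<rfloor> + 1 + i) / real (Suc m)"

lemma grid_nonneg: "0 \<le> grid m i h"
  by (simp add: grid_def)

lemma grid_gt: "h < grid m i h"
proof -
  have "real (Suc m) * h < real (nat \<lfloor>real (Suc m) * h\<rfloor> + 1 + i)" by linarith
  then show ?thesis by (simp add: grid_def field_simps)
qed

lemma grid_le: "0 \<le> h \<Longrightarrow> grid m i h \<le> h + (1 + real i) / real (Suc m)"
proof -
  assume "0 \<le> h"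
  then have "real (nat \<lfloor>real (Suc m) * h\<rfloor> + 1 + i) \<le> real (Suc m) * h + (1 + real i)"
    by (simp add: le_floor_iff)
  then have "grid m i h \<le> (real (Suc m) * h + (1 + real i)) / real (Suc m)"
    unfolding grid_def by (intro divide_right_mono) auto
  then show ?thesis by (simp add: add_divide_distrib)
qed

lemma grid_less_Suc: "h \<le> h' \<Longrightarrow> grid m i h < grid m (Suc i) h'"
proof -
  assume "h \<le> h'"
  then have "nat \<lfloor>real (Suc m) * h\<rfloor> \<le> nat \<lfloor>real (Suc m) * h'\<rfloor>"
    by (intro nat_mono floor_mono mult_left_mono) auto
  then show ?thesis unfolding grid_def by (intro divide_strict_right_mono) auto
qed

lemma grid_tendsto: "0 \<le> h \<Longrightarrow> (\<lambda>m. grid m i h) \<longlonglongrightarrow> h"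
proof (rule tendsto_sandwich[where f="\<lambda>_. h"])
  have "(\<lambda>m. h + (1 + real i) * inverse (real (Suc m))) \<longlonglongrightarrow> h + (1 + real i) * 0"
    by (intro tendsto_intros LIMSEQ_inverse_real_of_nat)
  then show "(\<lambda>m. h + (1 + real i) / real (Suc m)) \<longlonglongrightarrow> h" by (simp add: divide_inverse)
  show "\<forall>\<^sub>F m in sequentially. h \<le> grid m i h" by (intro always_eventually allI less_imp_le grid_gt)
qed (auto intro: always_eventually grid_le simp del: of_nat_Suc)

text \<open>The strictness of \<open>grid_gt\<close> puts the limit along \<open>at_right h\<close>,
  the filter in which right-continuity is formulated.\<close>

lemma filterlim_grid_at_right: "0 \<le> h \<Longrightarrow> filterlim (\<lambda>m. grid m i h) (at_right h) sequentially"
  using grid_tendsto[of h i] grid_gt[of h _ i]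
  by (auto simp: filterlim_at less_imp_neq[symmetric] intro!: always_eventually)

section \<open>Conditioning on the time change\<close>

context poisson_subordination
begin

text \<open>A convergent sequence of naturals is eventually constant, so on each trajectory the
  approximation is exact from some m on.\<close>

lemma eventually_N_grid:
  assumes "\<omega> \<in> space M" "0 \<le> h"
  shows "\<forall>\<^sub>F m in sequentially. N (grid m i h) \<omega> = N h \<omega>"
proof -
  have "continuous (at_right h) (\<lambda>t. real (N t \<omega>))"
    using N_additive assms by (simp add: additive_process_def cadlag_def)
  then have "((\<lambda>t. real (N t \<omega>)) \<longlongrightarrow> real (N h \<omega>)) (at_right h)"
    by (simp add: continuous_within)
  then have "(\<lambda>m. real (N (grid m i h) \<omega>)) \<longlonglongrightarrow> real (N h \<omega>)"
    by (rule filterlim_compose) (rule filterlim_grid_at_right[OF assms(2)])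
  then have "\<forall>\<^sub>F m in sequentially. dist (real (N (grid m i h) \<omega>)) (real (N h \<omega>)) < 1"
    by (rule tendstoD) simp
  then show ?thesis by eventually_elim (auto simp: dist_real_def)
qed

text \<open>The evaluation time depends on \<open>h\<close> only through a natural number, so a
  countable case distinction reduces the claim to \<open>N\<close> at fixed times.\<close>

lemma measurable_N_grid:
  assumes [measurable]: "h \<in> borel_measurable M"
  shows "(\<lambda>\<omega>. N (grid m i (h \<omega>)) \<omega>) \<in> M \<rightarrow>\<^sub>M count_space UNIV"
  unfolding grid_def
proof (rule measurable_compose_countable[where f="\<lambda>k. N (real (k + 1 + i) / real (Suc m))"])
  show "(\<lambda>\<omega>. nat \<lfloor>real (Suc m) * h \<omega>\<rfloor>) \<in> M \<rightarrow>\<^sub>M count_space UNIV" by measurable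
  show "N (real (k + 1 + i) / real (Suc m)) \<in> M \<rightarrow>\<^sub>M count_space UNIV" for k
    by (rule measurable_N) simp
qed

lemma measurable_X[measurable]:
  assumes "0 \<le> t"
  shows "X t \<in> M \<rightarrow>\<^sub>M count_space UNIV"
proof -
  have H[measurable]: "H t \<in> borel_measurable M" using assms by measurable
  have "(\<lambda>\<omega>. real (X t \<omega>)) \<in> borel_measurable M"
  proof (rule borel_measurable_LIMSEQ_metric)
    show "(\<lambda>\<omega>. real (N (grid m 0 (H t \<omega>)) \<omega>)) \<in> borel_measurable M" for m
      by (rule measurable_compose[OF measurable_N_grid]) auto
    fix \<omega> assume "\<omega> \<in> space M"
    then have "\<forall>\<^sub>F m in sequentially. N (grid m 0 (H t \<omega>)) \<omega> = X t \<omega>"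
      unfolding subordinated_def by (intro eventually_N_grid H_nonneg assms)
    then show "(\<lambda>m. real (N (grid m 0 (H t \<omega>)) \<omega>)) \<longlonglongrightarrow> real (X t \<omega>)"
      by (intro tendsto_eventually) (auto elim: eventually_mono)
  qed
  then have "(\<lambda>\<omega>. nat \<lfloor>real (X t \<omega>)\<rfloor>) \<in> M \<rightarrow>\<^sub>M count_space UNIV" by measurable
  then show ?thesis by simp
qed

lemma X_mono: "\<omega> \<in> space M \<Longrightarrow> 0 \<le> s \<Longrightarrow> s \<le> t \<Longrightarrow> X s \<omega> \<le> X t \<omega>"
  unfolding subordinated_def by (intro N_mono H_nonneg H_le)

lemma X_0: "\<omega> \<in> space M \<Longrightarrow> X 0 \<omega> = 0"
  by (simp add: subordinated_def H_0 N_0)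

text \<open>Fubini on pairs of paths: once the path of \<open>H\<close> is frozen, the grid times
  are deterministic and strictly increasing, and the independent increments of \<open>N\<close>
  evaluate the inner integral.\<close>

lemma expectation_prod_N_grid:
  assumes t0: "0 \<le> t 0" and t: "\<And>i. i < n \<Longrightarrow> t i < t (Suc i)"
    and \<phi>: "\<And>i k. \<bar>\<phi> i k\<bar> \<le> 1"
  shows "(\<integral>\<omega>. (\<Prod>i<n. \<phi> i (N (grid m (Suc i) (H (t (Suc i)) \<omega>)) \<omega> - N (grid m i (H (t i) \<omega>)) \<omega>)) \<partial>M) =
    (\<integral>\<omega>. (\<Prod>i<n. poisson_mean lam (\<phi> i) (grid m (Suc i) (H (t (Suc i)) \<omega>) - grid m i (H (t i) \<omega>))) \<partial>M)"
proof -
  have tnn: "0 \<le> t i" if "i \<le> n" for i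
    using t0 t that by (rule nonneg_of_increasing)
  let ?S = "PiM {0..} (\<lambda>_. borel) :: (real \<Rightarrow> real) measure"
  let ?Y = "\<lambda>\<omega>. \<lambda>t\<in>{0..}. real (N t \<omega>)" and ?Z = "\<lambda>\<omega>. \<lambda>t\<in>{0..}. H t \<omega>"
  let ?v = "\<lambda>y z i. y (grid m i (z (t i))) :: real"
  \<comment> \<open>\<open>F\<close> lives on arbitrary pairs of real functions; only on actual
    paths is it the product of increments, which is the content of \<open>FN\<close>.\<close>
  define F where "F = (\<lambda>(y, z). \<Prod>i<n. \<phi> i (nat \<lfloor>?v y z (Suc i) - ?v y z i\<rfloor>))"
  \<comment> \<open>The time at which \<open>y\<close> is evaluated depends on \<open>z\<close>, but
    it ranges over a countable set, so fixed coordinates of \<open>y\<close> suffice.\<close>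
  have v[measurable]: "(\<lambda>p. ?v (fst p) (snd p) i) \<in> borel_measurable (?S \<Otimes>\<^sub>M ?S)" if "i \<le> n" for i
    unfolding grid_def
  proof (rule measurable_compose_countable[where f="\<lambda>k p. fst p (real (k + 1 + i) / real (Suc m))"])
    have [measurable]: "(\<lambda>z. z (t i)) \<in> borel_measurable ?S"
      using tnn[OF that] by (intro measurable_component_singleton) auto
    show "(\<lambda>p. nat \<lfloor>real (Suc m) * snd p (t i)\<rfloor>) \<in> ?S \<Otimes>\<^sub>M ?S \<rightarrow>\<^sub>M count_space UNIV" by measurable
    have "(\<lambda>y. y (real (k + 1 + i) / real (Suc m))) \<in> borel_measurable ?S" for k
      by (intro measurable_component_singleton) auto
    then show "(\<lambda>p. fst p (real (k + 1 + i) / real (Suc m))) \<in> borel_measurable (?S \<Otimes>\<^sub>M ?S)" for k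
      by (rule measurable_compose[OF measurable_fst])
  qed
  have F: "F \<in> borel_measurable (?S \<Otimes>\<^sub>M ?S)"
    unfolding F_def case_prod_beta
  proof (rule borel_measurable_prod)
    fix i assume "i \<in> {..<n}"
    then have [measurable]: "(\<lambda>p. ?v (fst p) (snd p) (Suc i)) \<in> borel_measurable (?S \<Otimes>\<^sub>M ?S)"
      "(\<lambda>p. ?v (fst p) (snd p) i) \<in> borel_measurable (?S \<Otimes>\<^sub>M ?S)" using v by auto
    show "(\<lambda>p. \<phi> i (nat \<lfloor>?v (fst p) (snd p) (Suc i) - ?v (fst p) (snd p) i\<rfloor>)) \<in>
        borel_measurable (?S \<Otimes>\<^sub>M ?S)" by measurable
  qed
  have B: "\<bar>F p\<bar> \<le> 1" for p
    unfolding F_def case_prod_beta abs_prod using \<phi> by (intro prod_le_1) auto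
  have I: "indep_var ?S ?Y ?S ?Z" using indep by (simp add: indep_processes_def)
  have FN: "F (?Y \<omega>, ?Z \<omega>') = (\<Prod>i<n. \<phi> i (N (grid m (Suc i) (H (t (Suc i)) \<omega>')) \<omega> - N (grid m i (H (t i) \<omega>')) \<omega>))"
    if "\<omega> \<in> space M" "\<omega>' \<in> space M" for \<omega> \<omega>'
    unfolding F_def case_prod_conv
  proof (intro prod.cong refl)
    fix i assume "i \<in> {..<n}"
    then have i: "0 \<le> t i" "0 \<le> t (Suc i)" "t i \<le> t (Suc i)"
      using tnn[of i] tnn[of "Suc i"] t[of i] by auto
    have "N (grid m i (H (t i) \<omega>')) \<omega> \<le> N (grid m (Suc i) (H (t (Suc i)) \<omega>')) \<omega>"
      using that i by (intro N_mono grid_nonneg less_imp_le[OF grid_less_Suc] H_le)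
    then have "real (N (grid m (Suc i) (H (t (Suc i)) \<omega>')) \<omega>) - real (N (grid m i (H (t i) \<omega>')) \<omega>) =
      real (N (grid m (Suc i) (H (t (Suc i)) \<omega>')) \<omega> - N (grid m i (H (t i) \<omega>')) \<omega>)" by simp
    then show "\<phi> i (nat \<lfloor>?v (?Y \<omega>) (?Z \<omega>') (Suc i) - ?v (?Y \<omega>) (?Z \<omega>') i\<rfloor>) =
      \<phi> i (N (grid m (Suc i) (H (t (Suc i)) \<omega>')) \<omega> - N (grid m i (H (t i) \<omega>')) \<omega>)"
      using i by (simp only: restrict_apply atLeast_iff grid_nonneg if_True floor_of_nat nat_int)
  qed
  have "(\<integral>\<omega>. (\<Prod>i<n. \<phi> i (N (grid m (Suc i) (H (t (Suc i)) \<omega>)) \<omega> - N (grid m i (H (t i) \<omega>)) \<omega>)) \<partial>M) =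
    (\<integral>\<omega>. F (?Y \<omega>, ?Z \<omega>) \<partial>M)"
    by (intro Bochner_Integration.integral_cong refl FN[symmetric])
  also have "\<dots> = (\<integral>\<omega>'. (\<integral>\<omega>. F (?Y \<omega>, ?Z \<omega>') \<partial>M) \<partial>M)"
    by (rule expectation_indep_var[OF I F B])
  also have "\<dots> = (\<integral>\<omega>'. (\<Prod>i<n. poisson_mean lam (\<phi> i)
      (grid m (Suc i) (H (t (Suc i)) \<omega>') - grid m i (H (t i) \<omega>'))) \<partial>M)"
  proof (intro Bochner_Integration.integral_cong refl)
    fix \<omega>' assume \<omega>': "\<omega>' \<in> space M"
    have "(\<integral>\<omega>. F (?Y \<omega>, ?Z \<omega>') \<partial>M) =
      (\<integral>\<omega>. (\<Prod>i<n. \<phi> i (N (grid m (Suc i) (H (t (Suc i)) \<omega>')) \<omega> - N (grid m i (H (t i) \<omega>')) \<omega>)) \<partial>M)"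
      using \<omega>' by (intro Bochner_Integration.integral_cong refl FN)
    also have "\<dots> = (\<Prod>i<n. poisson_mean lam (\<phi> i)
      (grid m (Suc i) (H (t (Suc i)) \<omega>') - grid m i (H (t i) \<omega>')))"
    proof (rule expectation_prod_N_increments[where g="\<lambda>i. grid m i (H (t i) \<omega>')"])
      fix i assume "i < n"
      then show "grid m i (H (t i) \<omega>') < grid m (Suc i) (H (t (Suc i)) \<omega>')"
        using \<omega>' tnn[of i] t[of i] by (intro grid_less_Suc H_le) auto
    qed (use grid_nonneg \<phi> in auto)
    finally show "(\<integral>\<omega>. F (?Y \<omega>, ?Z \<omega>') \<partial>M) = (\<Prod>i<n. poisson_mean lam (\<phi> i)
      (grid m (Suc i) (H (t (Suc i)) \<omega>') - grid m i (H (t i) \<omega>')))" .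
  qed
  finally show ?thesis .
qed

text \<open>Both sides of \<open>expectation_prod_N_grid\<close> pass to the limit with dominating
  function 1: on the left each trajectory is eventually constant in m, on the right
  \<open>poisson_mean\<close> is continuous. The independent increments of \<open>H\<close> then
  split the product.\<close>

lemma expectation_prod_X_increments:
  assumes t0: "0 \<le> t 0" and t: "\<And>i. i < n \<Longrightarrow> t i < t (Suc i)"
    and \<phi>: "\<And>i k. \<bar>\<phi> i k\<bar> \<le> 1"
  shows "(\<integral>\<omega>. (\<Prod>i<n. \<phi> i (X (t (Suc i)) \<omega> - X (t i) \<omega>)) \<partial>M) =
    (\<Prod>i<n. \<integral>\<omega>. poisson_mean lam (\<phi> i) (H (t (Suc i)) \<omega> - H (t i) \<omega>) \<partial>M)"
proof -
  have tnn: "0 \<le> t i" if "i \<le> n" for i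
    using t0 t that by (rule nonneg_of_increasing)
  have [measurable]: "H (t i) \<in> borel_measurable M" if "i \<le> n" for i
    using tnn[OF that] by measurable
  have [measurable]: "poisson_mean lam (\<phi> i) \<in> borel_measurable borel" for i
    by (rule borel_measurable_poisson_mean[OF \<phi>])
  have [measurable]: "grid m i \<in> borel_measurable borel" for m i
    unfolding grid_def by measurable
  let ?NG = "\<lambda>m i \<omega>. N (grid m i (H (t i) \<omega>)) \<omega>" and ?HG = "\<lambda>m i \<omega>. grid m i (H (t i) \<omega>)"
  have NG: "?NG m i \<in> M \<rightarrow>\<^sub>M count_space UNIV" if "i \<le> n" for m i
    using that by (intro measurable_N_grid) measurable
  have L1: "(\<lambda>m. \<integral>\<omega>. (\<Prod>i<n. \<phi> i (?NG m (Suc i) \<omega> - ?NG m i \<omega>)) \<partial>M) \<longlonglongrightarrow>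
    (\<integral>\<omega>. (\<Prod>i<n. \<phi> i (X (t (Suc i)) \<omega> - X (t i) \<omega>)) \<partial>M)"
  proof (rule integral_dominated_convergence[where w="\<lambda>_. 1"])
    show "(\<lambda>\<omega>. \<Prod>i<n. \<phi> i (X (t (Suc i)) \<omega> - X (t i) \<omega>)) \<in> borel_measurable M"
    proof (rule borel_measurable_prod)
      fix i assume "i \<in> {..<n}"
      then have [measurable]: "X (t i) \<in> M \<rightarrow>\<^sub>M count_space UNIV" "X (t (Suc i)) \<in> M \<rightarrow>\<^sub>M count_space UNIV"
        using tnn[of i] tnn[of "Suc i"] by auto
      show "(\<lambda>\<omega>. \<phi> i (X (t (Suc i)) \<omega> - X (t i) \<omega>)) \<in> borel_measurable M" by measurable
    qed
    show "(\<lambda>\<omega>. \<Prod>i<n. \<phi> i (?NG m (Suc i) \<omega> - ?NG m i \<omega>)) \<in> borel_measurable M" for m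
    proof (rule borel_measurable_prod)
      fix i assume "i \<in> {..<n}"
      then have [measurable]: "?NG m i \<in> M \<rightarrow>\<^sub>M count_space UNIV" "?NG m (Suc i) \<in> M \<rightarrow>\<^sub>M count_space UNIV"
        using NG[of i m] NG[of "Suc i" m] by auto
      show "(\<lambda>\<omega>. \<phi> i (?NG m (Suc i) \<omega> - ?NG m i \<omega>)) \<in> borel_measurable M" by measurable
    qed
    show "AE \<omega> in M. norm (\<Prod>i<n. \<phi> i (?NG m (Suc i) \<omega> - ?NG m i \<omega>)) \<le> 1" for m
      using \<phi> by (intro AE_I2) (auto simp: abs_prod intro!: prod_le_1)
    show "AE \<omega> in M. (\<lambda>m. \<Prod>i<n. \<phi> i (?NG m (Suc i) \<omega> - ?NG m i \<omega>)) \<longlonglongrightarrow>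
      (\<Prod>i<n. \<phi> i (X (t (Suc i)) \<omega> - X (t i) \<omega>))"
    proof (intro AE_I2 tendsto_prod tendsto_eventually)
      fix \<omega> i assume \<omega>: "\<omega> \<in> space M" and i: "i \<in> {..<n}"
      have "\<forall>\<^sub>F m in sequentially. ?NG m i \<omega> = X (t i) \<omega>"
        "\<forall>\<^sub>F m in sequentially. ?NG m (Suc i) \<omega> = X (t (Suc i)) \<omega>"
        unfolding subordinated_def using \<omega> i tnn[of i] tnn[of "Suc i"]
        by (auto intro!: eventually_N_grid H_nonneg)
      then show "\<forall>\<^sub>F m in sequentially. \<phi> i (?NG m (Suc i) \<omega> - ?NG m i \<omega>) = \<phi> i (X (t (Suc i)) \<omega> - X (t i) \<omega>)"
        by eventually_elim simp
    qed
  qed auto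
  have L2: "(\<lambda>m. \<integral>\<omega>. (\<Prod>i<n. poisson_mean lam (\<phi> i) (?HG m (Suc i) \<omega> - ?HG m i \<omega>)) \<partial>M) \<longlonglongrightarrow>
    (\<integral>\<omega>. (\<Prod>i<n. poisson_mean lam (\<phi> i) (H (t (Suc i)) \<omega> - H (t i) \<omega>)) \<partial>M)"
  proof (rule integral_dominated_convergence[where w="\<lambda>_. 1"])
    show "(\<lambda>\<omega>. \<Prod>i<n. poisson_mean lam (\<phi> i) (H (t (Suc i)) \<omega> - H (t i) \<omega>)) \<in> borel_measurable M"
      by measurable
    show "(\<lambda>\<omega>. \<Prod>i<n. poisson_mean lam (\<phi> i) (?HG m (Suc i) \<omega> - ?HG m i \<omega>)) \<in> borel_measurable M" for m
      by measurable
    show "AE \<omega> in M. norm (\<Prod>i<n. poisson_mean lam (\<phi> i) (?HG m (Suc i) \<omega> - ?HG m i \<omega>)) \<le> 1" for m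
    proof (rule AE_I2)
      fix \<omega> assume \<omega>: "\<omega> \<in> space M"
      have "\<bar>poisson_mean lam (\<phi> i) (?HG m (Suc i) \<omega> - ?HG m i \<omega>)\<bar> \<le> 1" if "i < n" for i
      proof (rule abs_poisson_mean_le[OF \<phi>])
        have "?HG m i \<omega> < ?HG m (Suc i) \<omega>"
          using \<omega> that tnn[of i] t[of i] by (intro grid_less_Suc H_le) auto
        then show "0 \<le> lam * (?HG m (Suc i) \<omega> - ?HG m i \<omega>)" using lam_pos by simp
      qed
      then show "norm (\<Prod>i<n. poisson_mean lam (\<phi> i) (?HG m (Suc i) \<omega> - ?HG m i \<omega>)) \<le> 1"
        by (auto simp: abs_prod intro!: prod_le_1)
    qed
    show "AE \<omega> in M. (\<lambda>m. \<Prod>i<n. poisson_mean lam (\<phi> i) (?HG m (Suc i) \<omega> - ?HG m i \<omega>)) \<longlonglongrightarrow>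
      (\<Prod>i<n. poisson_mean lam (\<phi> i) (H (t (Suc i)) \<omega> - H (t i) \<omega>))"
      using tnn
      by (intro AE_I2 tendsto_prod isCont_tendsto_compose[OF isCont_poisson_mean[OF \<phi>]]
          tendsto_diff grid_tendsto H_nonneg) auto
  qed auto
  have "(\<lambda>m. \<integral>\<omega>. (\<Prod>i<n. poisson_mean lam (\<phi> i) (?HG m (Suc i) \<omega> - ?HG m i \<omega>)) \<partial>M) \<longlonglongrightarrow>
    (\<integral>\<omega>. (\<Prod>i<n. \<phi> i (X (t (Suc i)) \<omega> - X (t i) \<omega>)) \<partial>M)"
    using L1 by (rule Lim_transform_eventually)
      (intro always_eventually allI expectation_prod_N_grid[where t=t] t0 t \<phi>)
  with L2 have "(\<integral>\<omega>. (\<Prod>i<n. \<phi> i (X (t (Suc i)) \<omega> - X (t i) \<omega>)) \<partial>M) =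
      (\<integral>\<omega>. (\<Prod>i<n. poisson_mean lam (\<phi> i) (H (t (Suc i)) \<omega> - H (t i) \<omega>)) \<partial>M)"
    by (rule LIMSEQ_unique[rotated])
  also have "\<dots> = (\<Prod>i<n. \<integral>\<omega>. poisson_mean lam (\<phi> i) (H (t (Suc i)) \<omega> - H (t i) \<omega>) \<partial>M)"
  proof (rule indep_vars_lebesgue_integral)
    have "indep_vars (\<lambda>_. borel) (\<lambda>i \<omega>. H (t (Suc i)) \<omega> - H (t i) \<omega>) {..<n}"
      using H_additive t0 t by (simp add: additive_process_def indep_increments_def)
    then show "indep_vars (\<lambda>_. borel) (\<lambda>i \<omega>. poisson_mean lam (\<phi> i) (H (t (Suc i)) \<omega> - H (t i) \<omega>)) {..<n}"
      by (rule indep_vars_compose2) measurable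
    fix i assume i: "i \<in> {..<n}"
    then have [measurable]: "H (t i) \<in> borel_measurable M" "H (t (Suc i)) \<in> borel_measurable M"
      by simp_all
    show "integrable M (\<lambda>\<omega>. poisson_mean lam (\<phi> i) (H (t (Suc i)) \<omega> - H (t i) \<omega>))"
    proof (rule integrable_const_bound[of _ 1])
      show "AE \<omega> in M. norm (poisson_mean lam (\<phi> i) (H (t (Suc i)) \<omega> - H (t i) \<omega>)) \<le> 1"
        using i tnn[of i] t[of i] lam_pos
        by (auto intro!: AE_I2 abs_poisson_mean_le \<phi> H_le mult_nonneg_nonneg)
    qed measurable
  qed simp
  finally show ?thesis .
qed

lemma expectation_X_increment:
  assumes "0 \<le> s" "s < t" and \<phi>: "\<And>k. \<bar>\<phi> k\<bar> \<le> 1"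
  shows "(\<integral>\<omega>. \<phi> (X t \<omega> - X s \<omega>) \<partial>M) = (\<integral>\<omega>. poisson_mean lam \<phi> (H t \<omega> - H s \<omega>) \<partial>M)"
  using expectation_prod_X_increments[of "\<lambda>i. if i = 0 then s else t" 1 "\<lambda>_. \<phi>"] assms
  by simp

text \<open>The product formula expresses the left side through \<open>H\<close>; the formula for a
  single interval, read backwards, returns each factor to \<open>X\<close>.\<close>

lemma expectation_prod_X_increments_indep:
  fixes \<phi> :: "nat \<Rightarrow> nat \<Rightarrow> real"
  assumes t0: "0 \<le> t 0" and t: "\<And>i. i < n \<Longrightarrow> t i < t (Suc i)"
    and \<phi>: "\<And>i k. \<bar>\<phi> i k\<bar> \<le> 1"
  shows "(\<integral>\<omega>. (\<Prod>i<n. \<phi> i (X (t (Suc i)) \<omega> - X (t i) \<omega>)) \<partial>M) =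
    (\<Prod>i<n. \<integral>\<omega>. \<phi> i (X (t (Suc i)) \<omega> - X (t i) \<omega>) \<partial>M)"
proof -
  have tnn: "0 \<le> t i" if "i \<le> n" for i
    using t0 t that by (rule nonneg_of_increasing)
  have "(\<integral>\<omega>. (\<Prod>i<n. \<phi> i (X (t (Suc i)) \<omega> - X (t i) \<omega>)) \<partial>M) =
      (\<Prod>i<n. \<integral>\<omega>. poisson_mean lam (\<phi> i) (H (t (Suc i)) \<omega> - H (t i) \<omega>) \<partial>M)"
    using t0 t \<phi> by (rule expectation_prod_X_increments)
  also have "\<dots> = (\<Prod>i<n. \<integral>\<omega>. \<phi> i (X (t (Suc i)) \<omega> - X (t i) \<omega>) \<partial>M)"
    using tnn t \<phi> by (intro prod.cong refl expectation_X_increment[symmetric]) auto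
  finally show ?thesis .
qed

section \<open>Independence of increments and path regularity of the time-changed process\<close>

lemma indep_increments_X: "indep_increments M (\<lambda>t \<omega>. real (X t \<omega>))"
  unfolding indep_increments_def
proof (intro allI impI, elim conjE)
  fix n :: nat and t :: "nat \<Rightarrow> real"
  assume t0: "0 \<le> t 0" and t: "\<forall>i<n. t i < t (Suc i)"
  have tnn: "0 \<le> t i" if "i \<le> n" for i
    using t0 t[rule_format] that by (rule nonneg_of_increasing)
  let ?Y = "\<lambda>i \<omega>. real (X (t (Suc i)) \<omega>) - real (X (t i) \<omega>)"
  have X[measurable]: "X (t i) \<in> M \<rightarrow>\<^sub>M count_space UNIV" if "i \<le> n" for i
    using tnn[OF that] by (rule measurable_X)
  have Y: "?Y i \<in> borel_measurable M" if "i < n" for i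
  proof -
    have [measurable]: "X (t i) \<in> M \<rightarrow>\<^sub>M count_space UNIV" "X (t (Suc i)) \<in> M \<rightarrow>\<^sub>M count_space UNIV"
      using X that by auto
    show ?thesis by measurable
  qed
  have YX: "?Y i \<omega> = real (X (t (Suc i)) \<omega> - X (t i) \<omega>)" if "i < n" "\<omega> \<in> space M" for i \<omega>
    using X_mono[of \<omega> "t i" "t (Suc i)"] tnn[of i] t that by auto
  have "indep_sets (\<lambda>i. {?Y i -` A \<inter> space M |A. A \<in> sets borel}) {..<n}"
  proof (cases "n = 0")
    case True
    then show ?thesis by (simp add: indep_sets_def)
  next
    case False
    show ?thesis
    \<comment> \<open>Since \<open>space M\<close> lies in every generator, factorisation over the
      full index set covers all its subsets. The criterion is for nonempty index sets, hence the
      split on \<open>n = 0\<close>.\<close>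
    proof (subst indep_sets_finite)
      show "{?Y i -` A \<inter> space M |A. A \<in> sets borel} \<subseteq> events" if "i \<in> {..<n}" for i
        using Y[of i] that by (auto intro: measurable_sets)
      show "space M \<in> {?Y i -` A \<inter> space M |A. A \<in> sets borel}" for i
        by (auto intro!: exI[of _ UNIV])
      show "\<forall>A\<in>Pi {..<n} (\<lambda>i. {?Y i -` A \<inter> space M |A. A \<in> sets borel}).
          prob (\<Inter>j\<in>{..<n}. A j) = (\<Prod>j\<in>{..<n}. prob (A j))"
      proof
        fix A assume A: "A \<in> Pi {..<n} (\<lambda>i. {?Y i -` A \<inter> space M |A. A \<in> sets borel})"
        then have "\<forall>i\<in>{..<n}. \<exists>B. A i = ?Y i -` B \<inter> space M \<and> B \<in> sets borel"
          by (auto simp: Pi_iff)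
        then obtain B where B: "\<And>i. i < n \<Longrightarrow> A i = ?Y i -` B i \<inter> space M" "\<And>i. i < n \<Longrightarrow> B i \<in> sets borel"
          by (auto simp: bchoice_iff)
        have Aev: "A i \<in> events" if "i < n" for i
          unfolding B(1)[OF that] by (rule measurable_sets[OF Y[OF that] B(2)[OF that]])
        \<comment> \<open>Indicators are admissible test functions, and for them the product formula
          is the independence of the events.\<close>
        define \<phi> :: "nat \<Rightarrow> nat \<Rightarrow> real" where "\<phi> i k = indicator (B i) (real k)" for i k
        have iA: "\<phi> i (X (t (Suc i)) \<omega> - X (t i) \<omega>) = indicator (A i) \<omega>" if "i < n" "\<omega> \<in> space M" for i \<omega>
          unfolding B(1)[OF that(1)] \<phi>_def YX[OF that, symmetric] using that(2)
          by (simp add: indicator_def)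
        have "prob (\<Inter>j\<in>{..<n}. A j) = (\<integral>\<omega>. indicator (\<Inter>j\<in>{..<n}. A j) \<omega> \<partial>M)"
          using Aev False by (intro expectation_indicator[symmetric] sets.finite_INT) auto
        also have "\<dots> = (\<integral>\<omega>. (\<Prod>i<n. \<phi> i (X (t (Suc i)) \<omega> - X (t i) \<omega>)) \<partial>M)"
          using iA by (intro Bochner_Integration.integral_cong refl) (simp add: indicator_INT_prod)
        also have "\<dots> = (\<Prod>i<n. \<integral>\<omega>. \<phi> i (X (t (Suc i)) \<omega> - X (t i) \<omega>) \<partial>M)"
          using t0 t by (intro expectation_prod_X_increments_indep) (auto simp: \<phi>_def indicator_def)
        also have "\<dots> = (\<Prod>j\<in>{..<n}. prob (A j))"
        proof (intro prod.cong refl)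
          fix i assume i: "i \<in> {..<n}"
          have "(\<integral>\<omega>. \<phi> i (X (t (Suc i)) \<omega> - X (t i) \<omega>) \<partial>M) = (\<integral>\<omega>. indicator (A i) \<omega> \<partial>M)"
            using iA i by (intro Bochner_Integration.integral_cong refl) auto
          also have "\<dots> = prob (A i)"
            using Aev[of i] i by (intro expectation_indicator) auto
          finally show "(\<integral>\<omega>. \<phi> i (X (t (Suc i)) \<omega> - X (t i) \<omega>) \<partial>M) = prob (A i)" .
        qed
        finally show "prob (\<Inter>j\<in>{..<n}. A j) = (\<Prod>j\<in>{..<n}. prob (A j))" .
      qed
    qed (use False in auto)
  qed
  then show "indep_vars (\<lambda>_. borel) ?Y {..<n}"
    using Y by (simp add: indep_vars_def2)
qed

lemma cadlag_X:
  assumes \<omega>: "\<omega> \<in> space M"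
  shows "cadlag (\<lambda>t. real (X t \<omega>))"
  unfolding cadlag_def
proof (intro conjI allI impI)
  fix t :: real assume t: "0 \<le> t"
  \<comment> \<open>One-sided neighbourhoods include their endpoint: \<open>H\<close> may stay
    constant to the right of t, so \<open>H s \<omega>\<close> lies in
    \<open>{H t \<omega>..}\<close> but not necessarily strictly beyond
    \<open>H t \<omega>\<close>.\<close>
  have "continuous (at t within {t..}) (\<lambda>s. H s \<omega>)"
    using H_additive t \<omega> by (simp add: additive_process_def cadlag_def at_within_Ici_at_right)
  moreover have "continuous (at (H t \<omega>) within {H t \<omega>..}) (\<lambda>h. real (N h \<omega>))"
    using N_additive H_nonneg[OF \<omega> t] \<omega> by (simp add: additive_process_def cadlag_def at_within_Ici_at_right)
  then have "continuous (at (H t \<omega>) within (\<lambda>s. H s \<omega>) ` {t..}) (\<lambda>h. real (N h \<omega>))"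
    by (rule continuous_within_subset) (use t H_le[OF \<omega>] in auto)
  ultimately have "continuous (at t within {t..}) (\<lambda>s. real (N (H s \<omega>) \<omega>))"
    by (rule continuous_within_compose2)
  then show "continuous (at_right t) (\<lambda>t. real (X t \<omega>))"
    by (simp add: subordinated_def at_within_Ici_at_right)
next
  fix t :: real assume t: "0 < t"
  \<comment> \<open>For the left limit: before t the naturals \<open>X y \<omega>\<close> are
    bounded by \<open>X t \<omega>\<close>, so a maximum is attained at some s < t, and by
    monotonicity \<open>X\<close> is constant between s and t. \<open>Suc\<close> provides the
    strict bound.\<close>
  have "\<exists>s. (0 \<le> s \<and> s < t) \<and> (\<forall>y. 0 \<le> y \<and> y < t \<longrightarrow> X y \<omega> \<le> X s \<omega>)"
    by (rule ex_has_greatest_nat[where k=0 and b="Suc (X t \<omega>)"]) (use t X_mono[OF \<omega>] in \<open>auto intro: le_imp_less_Suc\<close>)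
  then obtain s where s: "0 \<le> s" "s < t" "\<And>y. 0 \<le> y \<Longrightarrow> y < t \<Longrightarrow> X y \<omega> \<le> X s \<omega>" by blast
  have "\<forall>\<^sub>F y in at_left t. real (X y \<omega>) = real (X s \<omega>)"
    using eventually_at_left_real[OF s(2)]
  proof eventually_elim
    case (elim y)
    then show ?case using s X_mono[OF \<omega>, of s y] by (auto intro!: antisym)
  qed
  then show "\<exists>l. ((\<lambda>t. real (X t \<omega>)) \<longlongrightarrow> l) (at_left t)"
    by (blast intro: tendsto_eventually)
qed

text \<open>As \<open>X 0 = 0\<close>, the value at \<tau> is itself an increment, independent of
  the next one. The cases \<tau> = 0 and t = 0 are separate because the product formula is for
  strictly increasing times.\<close>

lemma prob_X_increment:
  assumes \<tau>: "0 \<le> \<tau>" and t: "0 \<le> t"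
  shows "prob {\<omega> \<in> space M. X (\<tau> + t) \<omega> = k + n \<and> X \<tau> \<omega> = k} =
    prob {\<omega> \<in> space M. X \<tau> \<omega> = k} * prob {\<omega> \<in> space M. X (\<tau> + t) \<omega> - X \<tau> \<omega> = n}"
proof -
  have X[measurable]: "X \<tau> \<in> M \<rightarrow>\<^sub>M count_space UNIV" "X (\<tau> + t) \<in> M \<rightarrow>\<^sub>M count_space UNIV"
    using assms by (auto intro: measurable_X)
  have eq: "X (\<tau> + t) \<omega> = k + n \<and> X \<tau> \<omega> = k \<longleftrightarrow> X \<tau> \<omega> = k \<and> X (\<tau> + t) \<omega> - X \<tau> \<omega> = n"
    if "\<omega> \<in> space M" for \<omega>
    using X_mono[OF that \<tau>, of "\<tau> + t"] t by auto
  then have *: "{\<omega> \<in> space M. X (\<tau> + t) \<omega> = k + n \<and> X \<tau> \<omega> = k} =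
      {\<omega> \<in> space M. X \<tau> \<omega> = k \<and> X (\<tau> + t) \<omega> - X \<tau> \<omega> = n}" by blast
  consider "\<tau> = 0" | "t = 0" | "0 < \<tau>" "0 < t" using assms by linarith
  then show ?thesis
  proof cases
    case 1
    have k: "{\<omega> \<in> space M. X \<tau> \<omega> = k} = (if k = 0 then space M else {})"
      and kn: "{\<omega> \<in> space M. X \<tau> \<omega> = k \<and> X (\<tau> + t) \<omega> - X \<tau> \<omega> = n} =
        (if k = 0 then {\<omega> \<in> space M. X (\<tau> + t) \<omega> - X \<tau> \<omega> = n} else {})"
      unfolding 1 by (simp_all add: X_0 set_eq_iff conj_commute cong: conj_cong)
    show ?thesis unfolding * k kn by (simp add: prob_space)
  next
    case 2
    then show ?thesis
      unfolding * by (cases "n = 0") (auto simp: prob_space)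
  next
    case 3
    define u :: "nat \<Rightarrow> real" where "u i = (if i = 0 then 0 else if i = 1 then \<tau> else \<tau> + t)" for i
    define \<phi> :: "nat \<Rightarrow> nat \<Rightarrow> real" where "\<phi> i j = of_bool (j = (if i = 0 then k else n))" for i j
    have m[measurable]: "{\<omega> \<in> space M. X \<tau> \<omega> = k} \<in> events" "{\<omega> \<in> space M. X (\<tau> + t) \<omega> - X \<tau> \<omega> = n} \<in> events"
      "{\<omega> \<in> space M. X \<tau> \<omega> = k \<and> X (\<tau> + t) \<omega> - X \<tau> \<omega> = n} \<in> events" by measurable
    have "prob {\<omega> \<in> space M. X \<tau> \<omega> = k \<and> X (\<tau> + t) \<omega> - X \<tau> \<omega> = n} =
        (\<integral>\<omega>. indicator {\<omega> \<in> space M. X \<tau> \<omega> = k \<and> X (\<tau> + t) \<omega> - X \<tau> \<omega> = n} \<omega> \<partial>M)"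
      using m(3) by (rule expectation_indicator[symmetric])
    also have "\<dots> = (\<integral>\<omega>. (\<Prod>i<2. \<phi> i (X (u (Suc i)) \<omega> - X (u i) \<omega>)) \<partial>M)"
      using X_0 by (intro Bochner_Integration.integral_cong refl)
        (auto simp: u_def \<phi>_def numeral_2_eq_2 indicator_def)
    also have "\<dots> = (\<Prod>i<2. \<integral>\<omega>. \<phi> i (X (u (Suc i)) \<omega> - X (u i) \<omega>) \<partial>M)"
      using 3 by (intro expectation_prod_X_increments_indep) (auto simp: u_def \<phi>_def)
    also have "\<dots> = (\<integral>\<omega>. \<phi> 0 (X \<tau> \<omega> - X 0 \<omega>) \<partial>M) * (\<integral>\<omega>. \<phi> 1 (X (\<tau> + t) \<omega> - X \<tau> \<omega>) \<partial>M)"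
      by (simp add: u_def numeral_2_eq_2)
    also have "(\<integral>\<omega>. \<phi> 0 (X \<tau> \<omega> - X 0 \<omega>) \<partial>M) = (\<integral>\<omega>. indicator {\<omega> \<in> space M. X \<tau> \<omega> = k} \<omega> \<partial>M)"
      using X_0 by (intro Bochner_Integration.integral_cong refl) (auto simp: \<phi>_def indicator_def)
    also have "\<dots> = prob {\<omega> \<in> space M. X \<tau> \<omega> = k}"
      using m(1) by (rule expectation_indicator)
    also have "(\<integral>\<omega>. \<phi> 1 (X (\<tau> + t) \<omega> - X \<tau> \<omega>) \<partial>M) =
        (\<integral>\<omega>. indicator {\<omega> \<in> space M. X (\<tau> + t) \<omega> - X \<tau> \<omega> = n} \<omega> \<partial>M)"
      by (intro Bochner_Integration.integral_cong refl) (auto simp: \<phi>_def indicator_def)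
    also have "\<dots> = prob {\<omega> \<in> space M. X (\<tau> + t) \<omega> - X \<tau> \<omega> = n}"
      using m(2) by (rule expectation_indicator)
    finally show ?thesis unfolding * .
  qed
qed

end

section \<open>Bernstein functions\<close>

lemma nn_integral_exp_Ioc:
  assumes "0 < (u::real)" "0 \<le> x"
  shows "(\<integral>\<^sup>+y. ennreal (u * exp (- u * y)) * indicator {0<..x} y \<partial>lborel) = ennreal (1 - exp (- u * x))"
proof -
  have "(\<integral>\<^sup>+y. ennreal (u * exp (- u * y)) * indicator {0<..x} y \<partial>lborel) =
      (\<integral>\<^sup>+y. ennreal (u * exp (- u * y)) * indicator {0..x} y \<partial>lborel)"
    by (rule nn_integral_cong_AE) (use AE_lborel_singleton[of 0] in eventually_elim, auto simp: indicator_def)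
  also have "\<dots> = ennreal (- exp (- u * x) - (- exp (- u * 0)))"
    using assms by (intro nn_integral_FTC_Icc) (auto intro!: derivative_eq_intros)
  finally show ?thesis by simp
qed

lemma nn_integral_powr_atLeast:
  assumes "0 < (a::real)" "0 < y"
  shows "(\<integral>\<^sup>+x. ennreal (a * x powr (- a - 1)) * indicator {y..} x \<partial>lborel) = ennreal (y powr (- a))"
proof -
  have "(\<integral>\<^sup>+x. ennreal (a * x powr (- a - 1)) * indicator {y..} x \<partial>lborel) = ennreal (0 - (- (y powr (- a))))"
  proof (rule nn_integral_FTC_atLeast)
    fix x assume "y \<le> x"
    then show "((\<lambda>x. - (x powr (- a))) has_real_derivative a * x powr (- a - 1)) (at x)"
      using assms by (auto intro!: derivative_eq_intros)
    show "0 \<le> a * x powr (- a - 1)" using assms by simp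
  next
    have "((\<lambda>x. - (x powr (- a))) \<longlongrightarrow> - 0) at_top"
      using assms by (intro tendsto_minus tendsto_neg_powr filterlim_ident) auto
    then show "((\<lambda>x. - (x powr (- a))) \<longlongrightarrow> 0) at_top" by simp
  qed measurable
  then show ?thesis by simp
qed

text \<open>Euler's integral for \<open>Gamma (1 - a)\<close> after the substitution t = u y, which
  leaves a factor \<open>u powr (- a)\<close> to be compensated.\<close>

lemma nn_integral_exp_powr:
  assumes "0 < (u::real)" "a < 1"
  shows "(\<integral>\<^sup>+y. ennreal (u * exp (- u * y) * y powr (- a)) * indicator {0<..} y \<partial>lborel) =
    ennreal (u powr a * Gamma (1 - a))"
proof -
  have "ennreal (Gamma (1 - a)) =
      (\<integral>\<^sup>+t. ennreal (indicator {0..} t * t powr (1 - a - 1) / exp t) \<partial>lborel)"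
    using assms by (intro Gamma_conv_nn_integral_real) auto
  also have "\<dots> = ennreal \<bar>u\<bar> *
      (\<integral>\<^sup>+y. ennreal (indicator {0..} (0 + u * y) * (0 + u * y) powr (1 - a - 1) / exp (0 + u * y)) \<partial>lborel)"
    using assms by (intro nn_integral_real_affine) auto
  also have "\<dots> = (\<integral>\<^sup>+y. ennreal u * ennreal (indicator {0..} (0 + u * y) * (0 + u * y) powr (1 - a - 1) / exp (0 + u * y)) \<partial>lborel)"
    using assms by (subst nn_integral_cmult) auto
  finally have G: "ennreal (Gamma (1 - a)) = \<dots>" .
  have "ennreal (u powr a * Gamma (1 - a)) = ennreal (u powr a) * ennreal (Gamma (1 - a))"
    by (rule ennreal_mult') simp
  also have "\<dots> = (\<integral>\<^sup>+y. ennreal (u powr a) * (ennreal u *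
      ennreal (indicator {0..} (0 + u * y) * (0 + u * y) powr (1 - a - 1) / exp (0 + u * y))) \<partial>lborel)"
    unfolding G by (subst nn_integral_cmult) auto
  also have "\<dots> = (\<integral>\<^sup>+y. ennreal (u * exp (- u * y) * y powr (- a)) * indicator {0<..} y \<partial>lborel)"
  proof (rule nn_integral_cong_AE, use AE_lborel_singleton[of 0] in eventually_elim)
    fix y :: real assume "y \<noteq> 0"
    show "ennreal (u powr a) * (ennreal u *
      ennreal (indicator {0..} (0 + u * y) * (0 + u * y) powr (1 - a - 1) / exp (0 + u * y))) =
      ennreal (u * exp (- u * y) * y powr (- a)) * indicator {0<..} y"
    proof (cases "0 < y")
      case True
      then have "u powr a * (u * ((u * y) powr (- a) / exp (u * y))) =
          (u powr a * u powr (- a)) * (u * exp (- u * y) * y powr (- a))"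
        using assms by (simp add: powr_mult exp_minus divide_inverse)
      also have "u powr a * u powr (- a) = 1"
        using assms by (simp flip: powr_add)
      finally show ?thesis using True assms by (simp flip: ennreal_mult')
    next
      case False
      then have "u * y < 0" using \<open>y \<noteq> 0\<close> assms by (simp add: mult_pos_neg)
      then show ?thesis using False by simp
    qed
  qed
  finally show ?thesis by simp
qed

text \<open>Tonelli with \<open>1 - exp (- u x) = \<integral>\<^sub>0\<^sup>x u exp (- u y) dy\<close>.\<close>

lemma nn_integral_stable:
  assumes "0 < (u::real)" "0 < a" "a < 1"
  shows "(\<integral>\<^sup>+x. ennreal (1 - exp (- u * x)) * ennreal (a * x powr (- a - 1)) * indicator {0<..} x \<partial>lborel) =
    ennreal (u powr a * Gamma (1 - a))"
proof -
  \<comment> \<open>The integrand on the wedge 0 < y \<le> x: integrating out y gives the left side,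
    integrating out x leaves \<open>y powr (- a)\<close> against the exponential density.\<close>
  define K :: "real \<Rightarrow> real \<Rightarrow> ennreal" where
    "K x y = ennreal (u * exp (- u * y)) * ennreal (a * x powr (- a - 1)) *
      (if 0 < y \<and> y \<le> x then 1 else 0)" for x y
  have K: "(\<lambda>(x, y). K x y) \<in> borel_measurable (lborel \<Otimes>\<^sub>M lborel)"
    unfolding K_def by measurable
  have "(\<integral>\<^sup>+x. ennreal (1 - exp (- u * x)) * ennreal (a * x powr (- a - 1)) * indicator {0<..} x \<partial>lborel) =
      (\<integral>\<^sup>+x. (\<integral>\<^sup>+y. K x y \<partial>lborel) \<partial>lborel)"
  proof (rule nn_integral_cong)
    fix x :: real
    have "(\<integral>\<^sup>+y. K x y \<partial>lborel) = (\<integral>\<^sup>+y. (ennreal (u * exp (- u * y)) * indicator {0<..x} y) *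
        ennreal (a * x powr (- a - 1)) \<partial>lborel)"
      by (intro nn_integral_cong) (auto simp: K_def indicator_def)
    also have "\<dots> = (\<integral>\<^sup>+y. ennreal (u * exp (- u * y)) * indicator {0<..x} y \<partial>lborel) *
        ennreal (a * x powr (- a - 1))"
      by (rule nn_integral_multc) measurable
    also have "\<dots> = ennreal (1 - exp (- u * x)) * ennreal (a * x powr (- a - 1)) * indicator {0<..} x"
    proof (cases "0 < x")
      case True
      then show ?thesis using assms by (subst nn_integral_exp_Ioc) auto
    qed auto
    finally show "ennreal (1 - exp (- u * x)) * ennreal (a * x powr (- a - 1)) * indicator {0<..} x =
      (\<integral>\<^sup>+y. K x y \<partial>lborel)" by simp
  qed
  also have "\<dots> = (\<integral>\<^sup>+y. (\<integral>\<^sup>+x. K x y \<partial>lborel) \<partial>lborel)"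
    using K by (rule lborel_pair.Fubini'[symmetric])
  also have "\<dots> = (\<integral>\<^sup>+y. ennreal (u * exp (- u * y) * y powr (- a)) * indicator {0<..} y \<partial>lborel)"
  proof (rule nn_integral_cong)
    fix y :: real
    have "(\<integral>\<^sup>+x. K x y \<partial>lborel) = (\<integral>\<^sup>+x. (ennreal (u * exp (- u * y)) * indicator {0<..} y) *
        (ennreal (a * x powr (- a - 1)) * indicator {y..} x) \<partial>lborel)"
      by (intro nn_integral_cong) (auto simp: K_def indicator_def mult_ac)
    also have "\<dots> = (ennreal (u * exp (- u * y)) * indicator {0<..} y) *
        (\<integral>\<^sup>+x. ennreal (a * x powr (- a - 1)) * indicator {y..} x \<partial>lborel)"
      by (rule nn_integral_cmult) measurable
    also have "\<dots> = ennreal (u * exp (- u * y) * y powr (- a)) * indicator {0<..} y"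
    proof (cases "0 < y")
      case True
      then show ?thesis using assms by (subst nn_integral_powr_atLeast) (auto simp: ennreal_mult')
    qed auto
    finally show "(\<integral>\<^sup>+x. K x y \<partial>lborel) = ennreal (u * exp (- u * y) * y powr (- a)) * indicator {0<..} y" .
  qed
  also have "\<dots> = ennreal (u powr a * Gamma (1 - a))"
    by (rule nn_integral_exp_powr) fact+
  finally show ?thesis .
qed

text \<open>The normalisation of the Levy density cancels the Gamma factor of
  \<open>nn_integral_stable\<close>. The integrand is nonnegative, so the Bochner integral follows
  from the nonnegative one; that formula is for u > 0, and at u = 0 both sides vanish.\<close>

lemma Bernstein_fun_multistable_Levy:
  assumes "0 \<le> u" "0 < \<alpha> t" "\<alpha> t < 1"
  shows "Bernstein_fun (multistable_Levy \<alpha>) u t = u powr \<alpha> t"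
proof (cases "u = 0")
  case True
  then show ?thesis by (simp add: Bernstein_fun_def set_lebesgue_integral_def)
next
  case False
  define a where "a = \<alpha> t"
  have a: "0 < a" "a < 1" "0 < u" using assms False by (auto simp: a_def)
  have G: "0 < Gamma (1 - a)" using a by (intro Gamma_real_pos) auto
  let ?g = "\<lambda>x. indicator {0<..} x * (a * x powr (- a - 1) / Gamma (1 - a))"
  have "(\<integral>\<^sup>+x. ennreal (?g x * (indicator {0<..} x * (1 - exp (- u * x)))) \<partial>lborel) =
      (\<integral>\<^sup>+x. (ennreal (1 - exp (- u * x)) * ennreal (a * x powr (- a - 1)) * indicator {0<..} x) *
        ennreal (1 / Gamma (1 - a)) \<partial>lborel)"
    using a G by (intro nn_integral_cong) (auto simp: indicator_def mult_ac simp flip: ennreal_mult')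
  also have "\<dots> = ennreal (u powr a * Gamma (1 - a)) * ennreal (1 / Gamma (1 - a))"
    using a by (subst nn_integral_multc) (auto simp only: nn_integral_stable, measurable)
  also have "\<dots> = ennreal (u powr a)"
    using G by (simp flip: ennreal_mult'')
  finally have *: "(\<integral>\<^sup>+x. ennreal (?g x * (indicator {0<..} x * (1 - exp (- u * x)))) \<partial>lborel) = ennreal (u powr a)" .
  have "multistable_Levy \<alpha> t = density lborel (\<lambda>x. ennreal (?g x))"
    unfolding multistable_Levy_def a_def by (intro arg_cong2[where f=density]) (auto simp: indicator_def)
  then have "Bernstein_fun (multistable_Levy \<alpha>) u t =
      (\<integral>x. indicator {0<..} x * (1 - exp (- u * x)) \<partial>density lborel (\<lambda>x. ennreal (?g x)))"
    by (simp add: Bernstein_fun_def set_lebesgue_integral_def)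
  also have "\<dots> = (\<integral>x. ?g x * (indicator {0<..} x * (1 - exp (- u * x))) \<partial>lborel)"
    using a G by (subst integral_density) (auto simp: indicator_def)
  also have "\<dots> = u powr a"
    using * a G by (subst integral_eq_nn_integral) (auto simp: indicator_def)
  finally show ?thesis by (simp add: a_def)
qed

section \<open>The Dirac series and its binomial weights\<close>

lemma nn_integral_Dirac_series:
  assumes [measurable]: "f \<in> borel_measurable borel"
  shows "(\<integral>\<^sup>+x. f x \<partial>Dirac_series c) = (\<Sum>n. ennreal (c (Suc n)) * f (real (Suc n)))"
proof -
  have "(\<integral>\<^sup>+x. f x \<partial>Dirac_series c) = (\<integral>\<^sup>+n. ennreal (c n) * f (real n) \<partial>count_space {1..})"
    unfolding Dirac_series_def by (subst nn_integral_distr) (auto simp: nn_integral_density)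
  also have "\<dots> = (\<integral>\<^sup>+n. ennreal (c (Suc n)) * f (real (Suc n)) \<partial>count_space UNIV)"
    by (rule nn_integral_bij_count_space[symmetric], rule bij_betwI[where g = "\<lambda>n. n - 1"]) auto
  finally show ?thesis by (simp add: nn_integral_count_space_nat)
qed

text \<open>Newton's series of \<open>(1 - z) powr a\<close> with the constant term removed and the
  sign reversed.\<close>

lemma binomial_weight_power_sums:
  fixes a z :: real
  assumes "\<bar>z\<bar> < 1"
  shows "(\<lambda>n. (-1) ^ (Suc n + 1) * (a gchoose Suc n) * z ^ Suc n) sums (1 - (1 - z) powr a)"
proof -
  have "(\<lambda>n. (a gchoose n) * (- z) ^ n) sums (1 - z) powr a"
    using gen_binomial_real[of "- z" a] assms by simp
  then have "(\<lambda>n. (a gchoose Suc n) * (- z) ^ Suc n) sums ((1 - z) powr a - 1)"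
    by (subst sums_Suc_iff) simp
  from sums_minus[OF this] show ?thesis
    by (simp add: power_minus[of z] mult_ac)
qed

text \<open>Since all coefficients are positive, one may let \<open>z \<rightarrow> 1\<close> in the previous series.\<close>

lemma binomial_weight_sums:
  fixes a :: real
  assumes a: "0 < a" "a < 1"
  shows "(\<lambda>n. (-1) ^ (Suc n + 1) * (a gchoose Suc n)) sums 1"
proof -
  define w where "w n = (-1) ^ (Suc n + 1) * (a gchoose Suc n)" for n
  have w: "0 < w n" for n unfolding w_def by (rule multifractional_weight_pos[OF a])
  have S: "(\<lambda>n. w n * z ^ Suc n) sums (1 - (1 - z) powr a)" if "\<bar>z\<bar> < 1" for z
    unfolding w_def using binomial_weight_power_sums[OF that] .
  have ev: "\<forall>\<^sub>F z in at_left (1::real). 0 < z \<and> z < 1"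
    using eventually_at_left_real[of 0 1] by (auto elim: eventually_mono)
  \<comment> \<open>Upper bound: for z < 1 a partial sum stays below
    \<open>1 - (1 - z) powr a\<close>, hence below 1, and a finite sum is continuous at z =
    1.\<close>
  have le: "(\<Sum>n<m. w n) \<le> 1" for m
  proof (rule tendsto_upperbound)
    have "((\<lambda>z. \<Sum>n<m. w n * z ^ Suc n) \<longlongrightarrow> (\<Sum>n<m. w n * 1 ^ Suc n)) (at_left 1)"
      by (intro tendsto_intros)
    then show "((\<lambda>z. \<Sum>n<m. w n * z ^ Suc n) \<longlongrightarrow> (\<Sum>n<m. w n)) (at_left 1)" by simp
    show "\<forall>\<^sub>F z in at_left 1. (\<Sum>n<m. w n * z ^ Suc n) \<le> 1"
      using ev
    proof eventually_elim
      case (elim z)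
      then have "0 \<le> w n * z ^ Suc n" for n
        using w[of n] by (intro mult_nonneg_nonneg) auto
      then have "(\<Sum>n<m. w n * z ^ Suc n) \<le> 1 - (1 - z) powr a"
        using S[of z] elim sum_le_suminf[of "\<lambda>n. w n * z ^ Suc n" "{..<m}"]
        by (auto simp: sums_iff simp del: power_Suc)
      also have "\<dots> \<le> 1" by simp
      finally show ?case .
    qed
  qed simp
  have sm: "summable w"
    using w le by (intro summableI_nonneg_bounded[where x=1]) (auto intro: less_imp_le)
  have "suminf w \<le> 1" using le by (intro suminf_le_const sm)
  \<comment> \<open>Lower bound: the full sum dominates \<open>1 - (1 - z) powr a\<close>, which
    tends to 1 because a > 0.\<close>
  moreover have "1 - 0 \<le> suminf w"
  proof (rule tendsto_upperbound)
    have "((\<lambda>z. (1 - z) powr a) \<longlongrightarrow> 0) (at_left 1)"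
    proof (rule tendsto_zero_powrI)
      have "((\<lambda>z. 1 - z) \<longlongrightarrow> 1 - 1) (at_left (1::real))" by (intro tendsto_intros)
      then show "((\<lambda>z. 1 - z) \<longlongrightarrow> 0) (at_left (1::real))" by simp
      show "\<forall>\<^sub>F z in at_left (1::real). 0 \<le> 1 - z" using ev by (auto elim: eventually_mono)
    qed (use a in auto)
    then show "((\<lambda>z. 1 - (1 - z) powr a) \<longlongrightarrow> 1 - 0) (at_left 1)" by (intro tendsto_intros)
    show "\<forall>\<^sub>F z in at_left 1. 1 - (1 - z) powr a \<le> suminf w"
      using ev
    proof eventually_elim
      case (elim z)
      have "w n * z ^ Suc n \<le> w n" for n
        using elim w[of n] power_le_one[of z "Suc n"] by (intro mult_left_le) auto
      then show ?case using sums_le[OF _ S summable_sums[OF sm]] elim by auto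
    qed
  qed simp
  ultimately have "suminf w = 1" by simp
  with sm show ?thesis unfolding w_def[symmetric] by (simp add: sums_iff)
qed

text \<open>With z = \<open>exp (- u)\<close>, the factor \<open>1 - z ^ Suc n\<close> is the
  Bernstein integrand at the atom \<open>Suc n\<close>. For z < 1 the two preceding series are
  subtracted; at z = 1, which is u = 0, both sides vanish.\<close>

lemma binomial_weight_diff_sums:
  fixes a z :: real
  assumes a: "0 < a" "a < 1" and z: "0 \<le> z" "z \<le> 1"
  shows "(\<lambda>n. (-1) ^ (Suc n + 1) * (a gchoose Suc n) * (1 - z ^ Suc n)) sums (1 - z) powr a"
proof (cases "z = 1")
  case False
  then have "\<bar>z\<bar> < 1" using z by simp
  from sums_diff[OF binomial_weight_sums[OF a] binomial_weight_power_sums[OF this]] show ?thesis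
    by (simp add: algebra_simps)
qed simp

text \<open>On the atoms, which are integers from 1 on, \<open>min x 1\<close> equals 1, so the
  integral is the total mass \<open>lam powr \<alpha> t\<close>.\<close>

lemma pos_Levy_measure_multifractional_Levy:
  assumes "0 < lam" "0 < \<alpha> t" "\<alpha> t < 1"
  shows "pos_Levy_measure (multifractional_Levy lam \<alpha> t)"
proof -
  define w where "w n = lam powr \<alpha> t * ((-1) ^ (n + 1) * (\<alpha> t gchoose n))" for n
  have D: "multifractional_Levy lam \<alpha> t = Dirac_series w"
    by (simp add: multifractional_Levy_def w_def[abs_def])
  have w: "0 \<le> w (Suc n)" for n
    unfolding w_def using multifractional_weight_pos[OF assms(2,3), of n]
    by (intro mult_nonneg_nonneg[OF powr_ge_zero]) auto
  have "(\<lambda>n. w (Suc n)) sums (lam powr \<alpha> t * 1)"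
    unfolding w_def by (intro sums_mult binomial_weight_sums assms)
  then have "(\<Sum>n. ennreal (w (Suc n))) = ennreal (lam powr \<alpha> t * 1)"
    by (intro suminf_ennreal_eq w)
  moreover have "(\<integral>\<^sup>+x\<in>{0<..}. ennreal (min x 1) \<partial>Dirac_series w) = (\<Sum>n. ennreal (w (Suc n)))"
    by (subst nn_integral_Dirac_series) auto
  moreover have "emeasure (Dirac_series w) {..0} = 0"
    by (subst emeasure_Dirac_series) (auto simp: indicator_def)
  ultimately show ?thesis
    by (auto simp: pos_Levy_measure_def D Dirac_series_def)
qed

lemma Bernstein_fun_multifractional_Levy:
  assumes "0 < lam" "0 < \<alpha> t" "\<alpha> t < 1" "0 \<le> u"
  shows "Bernstein_fun (multifractional_Levy lam \<alpha>) u t = (lam * (1 - exp (- u))) powr \<alpha> t"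
proof -
  define w where "w n = lam powr \<alpha> t * ((-1) ^ (n + 1) * (\<alpha> t gchoose n))" for n
  have D: "multifractional_Levy lam \<alpha> t = Dirac_series w"
    by (simp add: multifractional_Levy_def w_def[abs_def])
  have w: "0 \<le> w (Suc n)" for n
    unfolding w_def using multifractional_weight_pos[OF assms(2,3), of n]
    by (intro mult_nonneg_nonneg[OF powr_ge_zero]) auto
  let ?f = "\<lambda>x. indicator {0<..} x * (1 - exp (- u * x))"
  have e: "exp (- (u * real n)) = exp (- u) ^ n" for n
    by (simp add: exp_of_nat_mult[symmetric] mult.commute)
  have "(\<integral>\<^sup>+x. ennreal (?f x) \<partial>Dirac_series w) =
      (\<Sum>n. ennreal (w (Suc n)) * ennreal (?f (real (Suc n))))"
    by (rule nn_integral_Dirac_series) measurable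
  also have "\<dots> = (\<Sum>n. ennreal (w (Suc n) * (1 - exp (- u) ^ Suc n)))"
    using w by (simp add: e ennreal_mult' del: of_nat_Suc power_Suc)
  also have "\<dots> = ennreal (lam powr \<alpha> t * (1 - exp (- u)) powr \<alpha> t)"
  proof (rule suminf_ennreal_eq)
    show "0 \<le> w (Suc n) * (1 - exp (- u) ^ Suc n)" for n
      using w assms(4) by (intro mult_nonneg_nonneg) (auto simp: power_le_one simp del: power_Suc)
    show "(\<lambda>n. w (Suc n) * (1 - exp (- u) ^ Suc n)) sums (lam powr \<alpha> t * (1 - exp (- u)) powr \<alpha> t)"
      unfolding w_def mult.assoc[of "lam powr \<alpha> t"]
      by (intro sums_mult binomial_weight_diff_sums assms) (use assms in auto)
  qed
  also have "lam powr \<alpha> t * (1 - exp (- u)) powr \<alpha> t = (lam * (1 - exp (- u))) powr \<alpha> t"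
    using assms by (simp add: powr_mult)
  finally have nn: "(\<integral>\<^sup>+x. ennreal (?f x) \<partial>Dirac_series w) = ennreal ((lam * (1 - exp (- u))) powr \<alpha> t)" .
  have "Bernstein_fun (multifractional_Levy lam \<alpha>) u t = (\<integral>x. ?f x \<partial>Dirac_series w)"
    by (simp add: Bernstein_fun_def set_lebesgue_integral_def D)
  also have "\<dots> = enn2real (\<integral>\<^sup>+x. ennreal (?f x) \<partial>Dirac_series w)"
    using assms by (intro integral_eq_nn_integral) (auto simp: indicator_def Dirac_series_def)
  finally show ?thesis unfolding nn by simp
qed

section \<open>The transition series\<close>

text \<open>Fubini for a dominated double series. The exchange takes place for unordered sums over
  pairs, where absolute summability permits it; the rest translates between \<open>infsum\<close>
  and \<open>suminf\<close>.\<close>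

lemma sums_swap:
  fixes a b :: "nat \<Rightarrow> nat \<Rightarrow> real"
  assumes ab: "\<And>r n. \<bar>a r n\<bar> \<le> b r n" and b: "\<And>r. b r sums B r" and B: "summable B"
  shows "summable (\<lambda>r. a r n)" and "(\<lambda>n. \<Sum>r. a r n) sums (\<Sum>r. \<Sum>n. a r n)"
proof -
  have b0: "0 \<le> b r n" for r n using order_trans[OF abs_ge_zero ab] .
  have B0: "0 \<le> B r" for r using sums_le[OF b0 sums_zero b] .
  have "b r n \<le> B r" for r n
    using sum_le_suminf[OF sums_summable[OF b], of "{n}" r] b0 b[of r] by (auto simp: sums_iff)
  then have aB: "norm (a r n) \<le> B r" for r n using ab order_trans by (metis real_norm_def)
  then show sa: "summable (\<lambda>r. a r n)" for n
    by (intro summable_comparison_test'[OF B]) auto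
  have "(\<lambda>p. case p of (r, n) \<Rightarrow> b r n) summable_on (UNIV \<times> UNIV)"
    using B B0 b0 b
    by (intro summable_on_SigmaI[where g=B]) (auto simp: summable_on_UNIV_nonneg_real_iff intro: sums_nonneg_imp_has_sum)
  then have "(\<lambda>p. norm (case p of (r, n) \<Rightarrow> a r n)) summable_on (UNIV \<times> UNIV)"
    by (rule Infinite_Sum.abs_summable_on_comparison_test') (use ab in auto)
  then have s: "(\<lambda>(r, n). a r n) summable_on (UNIV \<times> UNIV)"
    by (rule abs_summable_summable)
  have s': "(\<lambda>(n, r). a r n) summable_on (UNIV \<times> UNIV)"
    using summable_on_swap[of "\<lambda>(r, n). a r n" UNIV UNIV] s by (simp add: case_prod_unfold)
  have san: "summable (\<lambda>n. norm (a r n))" for r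
    using ab by (intro summable_comparison_test'[OF sums_summable[OF b[of r]]]) auto
  have nr: "infsum (\<lambda>n. a r n) UNIV = (\<Sum>n. a r n)" for r
    using norm_summable_imp_has_sum[OF san summable_sums[OF summable_norm_cancel[OF san]]] by (rule infsumI)
  have sar: "summable (\<lambda>r. norm (a r n))" for n
    using aB by (intro summable_comparison_test'[OF B]) auto
  have rn: "infsum (\<lambda>r. a r n) UNIV = (\<Sum>r. a r n)" for n
    using norm_summable_imp_has_sum[OF sar summable_sums[OF sa]] by (rule infsumI)
  have "norm (\<Sum>n. a r n) \<le> B r" for r
    using norm_suminf_le[of "a r" "b r"] ab b[of r] by (auto simp: sums_iff)
  then have sB: "summable (\<lambda>r. norm (\<Sum>n. a r n))"
    by (intro summable_comparison_test'[OF B]) auto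
  have "infsum (\<lambda>r. \<Sum>n. a r n) UNIV = (\<Sum>r. \<Sum>n. a r n)"
    using norm_summable_imp_has_sum[OF sB summable_sums[OF summable_norm_cancel[OF sB]]] by (rule infsumI)
  moreover have "infsum (\<lambda>r. \<Sum>n. a r n) UNIV = infsum (\<lambda>n. \<Sum>r. a r n) UNIV"
    using infsum_swap_banach[OF s] by (simp add: nr rn)
  moreover have "(\<lambda>n. \<Sum>r. a r n) summable_on UNIV"
    using summable_on_Sigma_banach[OF s'] by (simp add: rn)
  ultimately have "((\<lambda>n. \<Sum>r. a r n) has_sum (\<Sum>r. \<Sum>n. a r n)) UNIV"
    by (simp add: has_sum_iff)
  then show "(\<lambda>n. \<Sum>r. a r n) sums (\<Sum>r. \<Sum>n. a r n)" by (rule has_sum_imp_sums)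
qed

text \<open>Once the lower coefficients of the difference vanish, dividing by \<open>x ^ n\<close>
  and letting x tend to 0 isolates the n-th one.\<close>

lemma powser_sums_unique:
  fixes a b :: "nat \<Rightarrow> real"
  assumes s: "0 < s" and a: "\<And>x. \<bar>x\<bar> < s \<Longrightarrow> (\<lambda>n. a n * x ^ n) sums f x"
    and b: "\<And>x. \<bar>x\<bar> < s \<Longrightarrow> (\<lambda>n. b n * x ^ n) sums f x"
  shows "a n = b n"
proof -
  define c where "c n = a n - b n" for n
  have c: "(\<lambda>n. c n * x ^ n) sums 0" if "\<bar>x\<bar> < s" for x
    using sums_diff[OF a[OF that] b[OF that]] by (simp add: c_def algebra_simps)
  have "c n = 0"
  proof (induction n rule: less_induct)
    case (less n)
    have "(\<lambda>k. c (k + n) * x ^ k) sums 0" if "x \<noteq> 0" "norm x < s" for x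
    proof -
      have "(\<lambda>k. c (k + n) * x ^ (k + n)) sums (0 - (\<Sum>i<n. c i * x ^ i))"
        using c[of x] that by (subst sums_iff_shift) auto
      then have "(\<lambda>k. c (k + n) * x ^ (k + n) * (1 / x ^ n)) sums ((0 - (\<Sum>i<n. c i * x ^ i)) * (1 / x ^ n))"
        by (rule sums_mult2)
      then show ?thesis using less that by (simp add: power_add)
    qed
    then have "((\<lambda>_::real. 0) \<longlongrightarrow> c (0 + n)) (at 0)"
      by (rule powser_limit_0_strong[OF s])
    then show ?case using tendsto_unique[OF _ tendsto_const[of 0 "at (0::real)"]] by fastforce
  qed
  then show ?thesis by (simp add: c_def)
qed

text \<open>Factor by factor, \<bar>i - b\<bar> \<le> c + i. The bound is uniform in
  \<open>b\<close>, as required for \<beta>, which varies with the integration variables.\<close>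

lemma abs_gbinomial_le:
  fixes b c :: real
  assumes "0 \<le> b" "b \<le> c"
  shows "\<bar>b gchoose n\<bar> \<le> pochhammer c n / fact n"
proof -
  have "\<bar>pochhammer (- b) n\<bar> \<le> pochhammer c n"
    unfolding pochhammer_prod abs_prod using assms by (intro prod_mono) auto
  then show ?thesis
    by (simp add: gbinomial_pochhammer abs_mult divide_right_mono)
qed

text \<open>Newton's series with exponent \<open>- c\<close> at \<open>- z\<close>, where the signs
  cancel. For c = r it sums the majorants from \<open>abs_gbinomial_le\<close>.\<close>

lemma pochhammer_power_sums:
  fixes c z :: real
  assumes "0 \<le> z" "z < 1"
  shows "(\<lambda>n. pochhammer c n / fact n * z ^ n) sums (1 - z) powr (- c)"
proof -
  have "(\<lambda>n. (- c gchoose n) * (- z) ^ n) sums (1 + - z) powr (- c)"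
    using assms by (intro gen_binomial_real) auto
  then show ?thesis
    by (simp add: gbinomial_pochhammer power_minus[of z] mult_ac)
qed

section \<open>Integrals of the index function over cubes\<close>

locale index_function =
  fixes \<alpha> :: "real \<Rightarrow> real" and lam :: real
  assumes scale_pos: "0 < lam"
    and \<alpha>_measurable[measurable]: "\<alpha> \<in> borel_measurable borel"
    and \<alpha>_bounds: "\<And>s. 0 < \<alpha> s \<and> \<alpha> s < 1"
begin

text \<open>Passing to the base \<open>max 1 c\<close> makes the power increasing in the exponent,
  which can then be raised to 1.\<close>

lemma powr_index_le:
  assumes "0 \<le> (c::real)" shows "c powr \<alpha> s \<le> max 1 c"
proof -
  have "c powr \<alpha> s \<le> max 1 c powr \<alpha> s"
    using assms \<alpha>_bounds[of s] by (intro powr_mono2) auto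
  also have "\<dots> \<le> max 1 c powr 1" using \<alpha>_bounds[of s] by (intro powr_mono) auto
  finally show ?thesis by simp
qed

lemma integrable_powr_index:
  assumes "0 \<le> (c::real)"
  shows "integrable lborel (\<lambda>s. indicator {x..y} s * c powr \<alpha> s)"
proof (rule Bochner_Integration.integrable_bound)
  show "integrable lborel (\<lambda>s. indicator {x..y} s * (max 1 c))"
    by (cases "x \<le> y") auto
  show "AE s in lborel. norm (indicator {x..y} s * c powr \<alpha> s) \<le> norm (indicator {x..y} s * max 1 c)"
    using powr_index_le[OF assms] by (auto simp: indicator_def)
qed measurable

lemma set_integral_powr_index_le:
  assumes "0 \<le> (c::real)" "x \<le> y"
  shows "(LINT s:{x..y}|lborel. c powr \<alpha> s) \<le> max 1 c * (y - x)"
proof -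
  have int: "integrable lborel (\<lambda>s. indicator {x..y} s * max 1 c)"
    using assms by simp
  have "(LINT s:{x..y}|lborel. c powr \<alpha> s) \<le> (\<integral>s. indicator {x..y} s * max 1 c \<partial>lborel)"
    unfolding set_lebesgue_integral_def real_scaleR_def
    using assms powr_index_le by (intro integral_mono integrable_powr_index int) (auto simp: indicator_def)
  then show ?thesis using assms by (simp add: mult.commute)
qed

lemma \<beta>_bounds: "0 \<le> \<beta> \<alpha> r s" "\<beta> \<alpha> r s \<le> real r"
proof -
  show "0 \<le> \<beta> \<alpha> r s" unfolding \<beta>_def using \<alpha>_bounds by (intro sum_nonneg less_imp_le) auto
  have "\<beta> \<alpha> r s \<le> (\<Sum>j\<in>{1..r}. 1)" unfolding \<beta>_def using \<alpha>_bounds by (intro sum_mono less_imp_le) auto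
  then show "\<beta> \<alpha> r s \<le> real r" by simp
qed

lemma measurable_\<beta>[measurable]: "\<beta> \<alpha> r \<in> borel_measurable (PiM {1..r} (\<lambda>_. lborel))"
  unfolding \<beta>_def[abs_def] by measurable

text \<open>The integrand of \<open>transition_term\<close> with the cube as an indicator; the sign
  is left out, since \<open>(-1) ^ n\<close> is to be absorbed by the powers of \<open>- z\<close>
  in the binomial series.\<close>

definition cube_integrand :: "real \<Rightarrow> real \<Rightarrow> nat \<Rightarrow> nat \<Rightarrow> (nat \<Rightarrow> real) \<Rightarrow> real" where
  "cube_integrand x y n r s =
    indicator (PiE {1..r} (\<lambda>_. {x..y})) s * (lam powr \<beta> \<alpha> r s * (\<beta> \<alpha> r s gchoose n))"

text \<open>Membership in \<open>PiE\<close> also prescribes \<open>undefined\<close> outside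
  \<open>{1..r}\<close>, so the factorisation is restricted to the space of the product
  measure.\<close>

lemma indicator_PiE_prod:
  "s \<in> space (PiM {1..r::nat} (\<lambda>_. lborel)) \<Longrightarrow>
    (indicator (PiE {1..r} (\<lambda>_. {x..y})) s :: real) = (\<Prod>j\<in>{1..r}. indicator {x..y} (s j))"
proof (cases "\<forall>j\<in>{1..r}. s j \<in> {x..y}")
  case False
  assume "s \<in> space (PiM {1..r} (\<lambda>_. lborel))"
  from False obtain j where j: "j \<in> {1..r}" "s j \<notin> {x..y}" by blast
  then have "(\<Prod>j\<in>{1..r}. indicator {x..y} (s j) :: real) = 0" by (intro prod_zero bexI[of _ j]) auto
  moreover have "s \<notin> PiE {1..r} (\<lambda>_. {x..y})" using j by blast
  ultimately show ?thesis by simp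
next
  case True
  assume "s \<in> space (PiM {1..r} (\<lambda>_. lborel))"
  then have "s \<in> PiE {1..r} (\<lambda>_. {x..y})" using True by (auto simp: space_PiM PiE_iff)
  moreover have "(\<Prod>j\<in>{1..r}. indicator {x..y} (s j) :: real) = 1" using True by (intro prod.neutral) auto
  ultimately show ?thesis by simp
qed

lemma has_bochner_integral_cube:
  assumes "x \<le> y"
  shows "has_bochner_integral (PiM {1..r} (\<lambda>_. lborel))
    (indicator (PiE {1..r} (\<lambda>_. {x..y})) :: _ \<Rightarrow> real) ((y - x) ^ r)"
proof -
  interpret product_sigma_finite "\<lambda>_. lborel" ..
  have "integrable (PiM {1..r} (\<lambda>_. lborel)) (\<lambda>s. \<Prod>j\<in>{1..r}. indicator {x..y} (s j) :: real)"
    using assms by (intro product_integrable_prod) auto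
  moreover have "(\<integral>s. (\<Prod>j\<in>{1..r}. indicator {x..y} (s j)) \<partial>PiM {1..r} (\<lambda>_. lborel)) = (y - x) ^ r"
    using assms by (subst product_integral_prod) auto
  ultimately have "has_bochner_integral (PiM {1..r} (\<lambda>_. lborel))
      (\<lambda>s. \<Prod>j\<in>{1..r}. indicator {x..y} (s j) :: real) ((y - x) ^ r)"
    by (simp add: has_bochner_integral_iff)
  then show ?thesis
    by (subst has_bochner_integral_cong[OF refl indicator_PiE_prod refl])
qed

lemma sets_cube[measurable]: "PiE {1..r::nat} (\<lambda>_. {x..y}) \<in> sets (PiM {1..r} (\<lambda>_. lborel :: real measure))"
  by (rule sets_PiM_I_finite) auto

text \<open>Because \<beta> lies between 0 and r, the power is at most \<open>max 1 lam ^ r\<close>,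
  and \<open>abs_gbinomial_le\<close> applies with c = r. On the cube the bound is constant in
  \<open>s\<close>.\<close>

lemma abs_cube_integrand_le:
  "\<bar>cube_integrand x y n r s\<bar> \<le>
    max 1 lam ^ r * (pochhammer (real r) n / fact n) * indicator (PiE {1..r} (\<lambda>_. {x..y})) s"
proof -
  have "lam powr \<beta> \<alpha> r s \<le> max 1 lam powr \<beta> \<alpha> r s"
    using scale_pos \<beta>_bounds by (intro powr_mono2) auto
  also have "\<dots> \<le> max 1 lam powr real r" using \<beta>_bounds by (intro powr_mono) auto
  finally have l: "lam powr \<beta> \<alpha> r s \<le> max 1 lam ^ r" by (simp add: powr_realpow)
  have "lam powr \<beta> \<alpha> r s * \<bar>\<beta> \<alpha> r s gchoose n\<bar> \<le> max 1 lam ^ r * (pochhammer (real r) n / fact n)"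
    by (intro mult_mono l abs_gbinomial_le \<beta>_bounds) auto
  then show ?thesis by (auto simp: cube_integrand_def indicator_def abs_mult)
qed

lemma measurable_cube_integrand[measurable]:
  "cube_integrand x y n r \<in> borel_measurable (PiM {1..r} (\<lambda>_. lborel))"
  unfolding cube_integrand_def[abs_def] gbinomial_prod_rev by measurable

lemma cube_integrand_bounds:
  assumes "x \<le> y"
  shows "integrable (PiM {1..r} (\<lambda>_. lborel)) (cube_integrand x y n r)"
    and "(\<integral>s. \<bar>cube_integrand x y n r s\<bar> \<partial>PiM {1..r} (\<lambda>_. lborel)) \<le>
      (max 1 lam * (y - x)) ^ r * (pochhammer (real r) n / fact n)"
proof -
  let ?C = "max 1 lam ^ r * (pochhammer (real r) n / fact n)"
  have C: "has_bochner_integral (PiM {1..r} (\<lambda>_. lborel))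
      (\<lambda>s. ?C * indicator (PiE {1..r} (\<lambda>_. {x..y})) s) (?C * (y - x) ^ r)"
    by (intro has_bochner_integral_mult_right has_bochner_integral_cube assms)
  show int: "integrable (PiM {1..r} (\<lambda>_. lborel)) (cube_integrand x y n r)"
  proof (rule Bochner_Integration.integrable_bound[OF integrable.intros[OF C]])
    show "AE s in PiM {1..r} (\<lambda>_. lborel). norm (cube_integrand x y n r s) \<le>
        norm (?C * indicator (PiE {1..r} (\<lambda>_. {x..y})) s)"
      unfolding real_norm_def by (intro AE_I2 order_trans[OF abs_cube_integrand_le abs_ge_self])
  qed (rule measurable_cube_integrand)
  have "(\<integral>s. \<bar>cube_integrand x y n r s\<bar> \<partial>PiM {1..r} (\<lambda>_. lborel)) \<le> ?C * (y - x) ^ r"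
    unfolding has_bochner_integral_integral_eq[OF C, symmetric]
    using int C abs_cube_integrand_le by (intro integral_mono) (auto simp: has_bochner_integral_iff)
  then show "(\<integral>s. \<bar>cube_integrand x y n r s\<bar> \<partial>PiM {1..r} (\<lambda>_. lborel)) \<le>
      (max 1 lam * (y - x)) ^ r * (pochhammer (real r) n / fact n)"
    by (simp add: power_mult_distrib mult_ac)
qed

lemma transition_term_eq:
  "transition_term lam \<alpha> \<tau> t n r = (-1) ^ (n + r) / fact r *
    (\<integral>s. cube_integrand \<tau> (\<tau> + t) n r s \<partial>PiM {1..r} (\<lambda>_. lborel))"
  by (simp add: transition_term_def set_lebesgue_integral_def cube_integrand_def)

lemma abs_transition_term_le:
  assumes "0 \<le> t"
  shows "\<bar>transition_term lam \<alpha> \<tau> t n r\<bar> \<le>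
    (max 1 lam * t) ^ r / fact r * (pochhammer (real r) n / fact n)"
proof -
  let ?P = "PiM {1..r} (\<lambda>_. lborel) :: (nat \<Rightarrow> real) measure"
  have "\<bar>transition_term lam \<alpha> \<tau> t n r\<bar> = \<bar>\<integral>s. cube_integrand \<tau> (\<tau> + t) n r s \<partial>?P\<bar> / fact r"
    by (simp add: transition_term_eq abs_mult)
  also have "\<dots> \<le> (max 1 lam * t) ^ r * (pochhammer (real r) n / fact n) / fact r"
  proof (rule divide_right_mono)
    have "\<bar>\<integral>s. cube_integrand \<tau> (\<tau> + t) n r s \<partial>?P\<bar> \<le> (\<integral>s. \<bar>cube_integrand \<tau> (\<tau> + t) n r s\<bar> \<partial>?P)"
      by (rule integral_abs_bound)
    also have "\<dots> \<le> (max 1 lam * t) ^ r * (pochhammer (real r) n / fact n)"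
      using cube_integrand_bounds(2)[of \<tau> "\<tau> + t" r n] assms by simp
    finally show "\<bar>\<integral>s. cube_integrand \<tau> (\<tau> + t) n r s \<partial>?P\<bar> \<le>
        (max 1 lam * t) ^ r * (pochhammer (real r) n / fact n)" .
  qed simp
  also have "\<dots> = (max 1 lam * t) ^ r / fact r * (pochhammer (real r) n / fact n)" by simp
  finally show ?thesis .
qed

text \<open>For fixed r the binomial series in n is summed under the integral and gives
  \<open>(lam * (1 - z)) powr \<beta> \<alpha> r s\<close>. As \<beta> is a sum over the
  coordinates, this is a product of one-variable functions, and the cube integral becomes an r-th
  power.\<close>

lemma transition_term_power_sums:
  assumes "0 \<le> t" "\<bar>z\<bar> < 1"
  shows "(\<lambda>n. transition_term lam \<alpha> \<tau> t n r * z ^ n) sums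
    ((- (LINT s:{\<tau>..\<tau> + t}|lborel. (lam * (1 - z)) powr \<alpha> s)) ^ r / fact r)"
proof -
  interpret product_sigma_finite "\<lambda>_. lborel :: real measure" ..
  let ?P = "PiM {1..r} (\<lambda>_. lborel) :: (nat \<Rightarrow> real) measure"
  let ?I = "cube_integrand \<tau> (\<tau> + t)"
  have int: "integrable ?P (?I n r)" for n using assms by (intro cube_integrand_bounds) auto
  have z: "0 < 1 - z" "\<bar>- z\<bar> < 1" using assms by auto
  have zn: "norm (?I n r s * (- z) ^ n) = \<bar>?I n r s\<bar> * \<bar>z\<bar> ^ n" for n s
    by (simp add: abs_mult power_abs)
  have ps: "(\<lambda>n. pochhammer (real r) n / fact n * \<bar>z\<bar> ^ n) sums (1 - \<bar>z\<bar>) powr (- real r)"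
    using assms by (intro pochhammer_power_sums) auto
  have "(\<lambda>n. \<integral>s. ?I n r s * (- z) ^ n \<partial>?P) sums (\<integral>s. (\<Sum>n. ?I n r s * (- z) ^ n) \<partial>?P)"
  proof (rule sums_integral)
    show "integrable ?P (\<lambda>s. ?I n r s * (- z) ^ n)" for n using int by auto
    show "AE s in ?P. summable (\<lambda>n. norm (?I n r s * (- z) ^ n))"
    proof (rule AE_I2, rule summable_comparison_test')
      fix s
      let ?C = "max 1 lam ^ r * indicator (PiE {1..r} (\<lambda>_. {\<tau>..\<tau> + t})) s :: real"
      show "summable (\<lambda>n. ?C * (pochhammer (real r) n / fact n * \<bar>z\<bar> ^ n))"
        by (intro summable_mult sums_summable[OF ps])
      show "norm (norm (?I n r s * (- z) ^ n)) \<le> ?C * (pochhammer (real r) n / fact n * \<bar>z\<bar> ^ n)" if "n \<ge> 0" for n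
        using mult_right_mono[OF abs_cube_integrand_le[of \<tau> "\<tau> + t" n r s], of "\<bar>z\<bar> ^ n"]
        by (simp add: abs_mult power_abs mult_ac)
    qed
    show "summable (\<lambda>n. \<integral>s. norm (?I n r s * (- z) ^ n) \<partial>?P)"
      unfolding zn
    proof (rule summable_comparison_test')
      show "summable (\<lambda>n. (max 1 lam * t) ^ r * (pochhammer (real r) n / fact n * \<bar>z\<bar> ^ n))"
        by (intro summable_mult sums_summable[OF ps])
      show "norm (\<integral>s. \<bar>?I n r s\<bar> * \<bar>z\<bar> ^ n \<partial>?P) \<le> (max 1 lam * t) ^ r * (pochhammer (real r) n / fact n * \<bar>z\<bar> ^ n)"
        if "n \<ge> 0" for n
        using mult_right_mono[OF cube_integrand_bounds(2)[of \<tau> "\<tau> + t" r n], of "\<bar>z\<bar> ^ n"] assms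
        by (simp add: abs_mult mult_ac)
    qed
  qed
  also have "(\<integral>s. (\<Sum>n. ?I n r s * (- z) ^ n) \<partial>?P) =
      (\<integral>s. (\<Prod>j\<in>{1..r}. indicator {\<tau>..\<tau> + t} (s j) * (lam * (1 - z)) powr \<alpha> (s j)) \<partial>?P)"
  proof (intro Bochner_Integration.integral_cong refl)
    fix s assume s: "s \<in> space ?P"
    let ?b = "\<beta> \<alpha> r s" and ?i = "indicator (PiE {1..r} (\<lambda>_. {\<tau>..\<tau> + t})) s :: real"
    have "(\<lambda>n. (?b gchoose n) * (- z) ^ n) sums (1 - z) powr ?b"
      using gen_binomial_real[OF z(2), of ?b] by simp
    from sums_mult[OF this, of "?i * lam powr ?b"]
    have "(\<Sum>n. ?I n r s * (- z) ^ n) = ?i * lam powr ?b * (1 - z) powr ?b"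
      by (simp add: sums_iff cube_integrand_def mult_ac)
    also have "\<dots> = ?i * (lam * (1 - z)) powr ?b"
      using scale_pos z by (simp add: powr_mult)
    also have "(lam * (1 - z)) powr ?b = (\<Prod>j\<in>{1..r}. (lam * (1 - z)) powr \<alpha> (s j))"
      unfolding \<beta>_def using scale_pos z by (intro powr_sum) auto
    also have "?i = (\<Prod>j\<in>{1..r}. indicator {\<tau>..\<tau> + t} (s j))"
      by (rule indicator_PiE_prod[OF s])
    finally show "(\<Sum>n. ?I n r s * (- z) ^ n) =
        (\<Prod>j\<in>{1..r}. indicator {\<tau>..\<tau> + t} (s j) * (lam * (1 - z)) powr \<alpha> (s j))"
      by (simp add: prod.distrib)
  qed
  also have "\<dots> = (\<Prod>j\<in>{1..r}. \<integral>s. indicator {\<tau>..\<tau> + t} s * (lam * (1 - z)) powr \<alpha> s \<partial>lborel)"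
    using scale_pos z by (intro product_integral_prod integrable_powr_index) auto
  also have "\<dots> = (LINT s:{\<tau>..\<tau> + t}|lborel. (lam * (1 - z)) powr \<alpha> s) ^ r"
    by (simp add: set_lebesgue_integral_def)
  finally have "(\<lambda>n. \<integral>s. ?I n r s * (- z) ^ n \<partial>?P) sums
      (LINT s:{\<tau>..\<tau> + t}|lborel. (lam * (1 - z)) powr \<alpha> s) ^ r" .
  \<comment> \<open>Of the sign \<open>(-1) ^ (n + r)\<close>, the part in n turns
    \<open>- z\<close> back into \<open>z\<close>, and the part in r negates the integral under the
    power.\<close>
  from sums_mult[OF this, of "(-1) ^ r / fact r"] show ?thesis
    by (simp add: transition_term_eq power_add power_minus[of z] power_minus[of "set_lebesgue_integral _ _ _"] mult_ac)
qed

text \<open>Summed over n first, the double series is the exponential series of the negated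
  integral; summed over r first, it is a power series in z with the desired coefficients.\<close>

lemma transition_series:
  assumes t: "0 \<le> t" and z: "\<bar>z\<bar> < 1"
  shows "summable (\<lambda>r. transition_term lam \<alpha> \<tau> t n r)"
    and "(\<lambda>n. (\<Sum>r. transition_term lam \<alpha> \<tau> t n r) * z ^ n) sums
      exp (- (LINT s:{\<tau>..\<tau> + t}|lborel. (lam * (1 - z)) powr \<alpha> s))"
proof -
  let ?T = "transition_term lam \<alpha> \<tau> t" and ?L = "max 1 lam * t"
  let ?F = "\<lambda>z. LINT s:{\<tau>..\<tau> + t}|lborel. (lam * (1 - z)) powr \<alpha> s"
  have sw: "summable (\<lambda>r. ?T n r * z ^ n)"
    "(\<lambda>n. \<Sum>r. ?T n r * z ^ n) sums (\<Sum>r. \<Sum>n. ?T n r * z ^ n)" if z: "\<bar>z\<bar> < 1" for z n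
  proof -
    let ?b = "\<lambda>r n. ?L ^ r / fact r * (pochhammer (real r) n / fact n * \<bar>z\<bar> ^ n)"
    have ab: "\<bar>?T n r * z ^ n\<bar> \<le> ?b r n" for r n
      using mult_right_mono[OF abs_transition_term_le[OF t, of \<tau> n r], of "\<bar>z\<bar> ^ n"]
      by (simp add: abs_mult power_abs mult_ac)
    have b: "?b r sums (?L ^ r / fact r * (1 - \<bar>z\<bar>) powr (- real r))" for r
      using z by (intro sums_mult pochhammer_power_sums) auto
    \<comment> \<open>The majorants, summed over n, form the exponential series at
      \<open>?L / (1 - \<bar>z\<bar>)\<close> and are therefore summable however large
      \<open>?L\<close> is.\<close>
    have "c ^ r / fact r * q powr (- real r) = (c / q) ^ r /\<^sub>R fact r" if "0 < q" for c q :: real and r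
      using that by (simp add: powr_minus powr_realpow divide_inverse power_mult_distrib power_inverse)
    then have B: "summable (\<lambda>r. ?L ^ r / fact r * (1 - \<bar>z\<bar>) powr (- real r))"
      using summable_exp_generic[of "?L / (1 - \<bar>z\<bar>)"] z by simp
    show "summable (\<lambda>r. ?T n r * z ^ n)" "(\<lambda>n. \<Sum>r. ?T n r * z ^ n) sums (\<Sum>r. \<Sum>n. ?T n r * z ^ n)"
      using sums_swap[OF ab b B] by auto
  qed
  show st: "summable (\<lambda>r. ?T n r)" for n
  proof -
    \<comment> \<open>Any nonzero point of the disc serves here, as its n-th power is divided out
      again.\<close>
    have "summable (\<lambda>r. ?T n r * (1 / 2) ^ n * 2 ^ n)"
      by (intro summable_mult2 sw) simp
    moreover have "?T n r * (1 / 2) ^ n * 2 ^ n = ?T n r" for r by (simp add: power_divide)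
    ultimately show ?thesis by simp
  qed
  have "(\<Sum>n. ?T n r * z ^ n) = (- ?F z) ^ r /\<^sub>R fact r" for r
    using transition_term_power_sums[OF t z, of \<tau> r] by (simp add: sums_iff divide_inverse mult.commute)
  then have "(\<Sum>r. \<Sum>n. ?T n r * z ^ n) = exp (- ?F z)"
    using exp_converges[of "- ?F z"] by (simp add: sums_iff)
  moreover have "(\<Sum>r. ?T n r * z ^ n) = (\<Sum>r. ?T n r) * z ^ n" for n
    by (rule suminf_mult2[OF st, symmetric])
  ultimately show "(\<lambda>n. (\<Sum>r. ?T n r) * z ^ n) sums exp (- ?F z)"
    using sw(2)[OF z] by simp
qed

text \<open>The empty sum \<beta> is 0 and \<open>0 gchoose n\<close> vanishes for n \<ge> 1. This
  reconciles the exponential series, starting at r = 0, with the transition series, starting at r =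
  1.\<close>

lemma transition_term_0:
  assumes "1 \<le> n" shows "transition_term lam \<alpha> \<tau> t n 0 = 0"
  using assms by (simp add: transition_term_def \<beta>_def gbinomial_0_left set_lebesgue_integral_def)

end

section \<open>The space-multifractional Poisson process\<close>

locale multifractional_poisson = poisson_subordination M N H lam + index_function \<alpha> lam
  for M :: "'a measure" and N H lam \<alpha> +
  assumes H_Laplace: "\<And>u s t. 0 \<le> u \<Longrightarrow> 0 \<le> s \<Longrightarrow> s \<le> t \<Longrightarrow>
    (\<integral>\<omega>. exp (- u * (H t \<omega> - H s \<omega>)) \<partial>M) = exp (- (LINT \<tau>:{s..t}|lborel. u powr \<alpha> \<tau>))"
begin

lemma expectation_power_X_increment:
  assumes s: "0 \<le> s" "s \<le> t" and z: "\<bar>z\<bar> \<le> 1"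
  shows "(\<integral>\<omega>. z ^ (X t \<omega> - X s \<omega>) \<partial>M) =
    exp (- (LINT \<tau>:{s..t}|lborel. (lam * (1 - z)) powr \<alpha> \<tau>))"
proof -
  have u: "0 \<le> lam * (1 - z)" using lam_pos z by simp
  have "(\<integral>\<omega>. z ^ (X t \<omega> - X s \<omega>) \<partial>M) = (\<integral>\<omega>. exp (- (lam * (1 - z)) * (H t \<omega> - H s \<omega>)) \<partial>M)"
  \<comment> \<open>Conditioning is available for s < t only; for s = t both increments are
    0.\<close>
  proof (cases "s = t")
    case False
    then have "(\<integral>\<omega>. z ^ (X t \<omega> - X s \<omega>) \<partial>M) =
        (\<integral>\<omega>. poisson_mean lam (\<lambda>k. z ^ k) (H t \<omega> - H s \<omega>) \<partial>M)"
      using s z by (intro expectation_X_increment) (auto simp: power_abs power_le_one)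
    then show ?thesis unfolding poisson_mean_power .
  qed simp
  also have "\<dots> = exp (- (LINT \<tau>:{s..t}|lborel. (lam * (1 - z)) powr \<alpha> \<tau>))"
    using u s by (rule H_Laplace)
  finally show ?thesis .
qed

lemma measurable_X_increment:
  assumes "0 \<le> s" "s \<le> t"
  shows "(\<lambda>\<omega>. X t \<omega> - X s \<omega>) \<in> M \<rightarrow>\<^sub>M count_space UNIV"
proof -
  have [measurable]: "X s \<in> M \<rightarrow>\<^sub>M count_space UNIV" "X t \<in> M \<rightarrow>\<^sub>M count_space UNIV"
    using assms by (auto intro: measurable_X)
  show ?thesis by measurable
qed

lemma prob_X_increment_power_sums:
  assumes s: "0 \<le> s" "s \<le> t" and z: "\<bar>z\<bar> \<le> 1"
  shows "(\<lambda>n. prob {\<omega> \<in> space M. X t \<omega> - X s \<omega> = n} * z ^ n) sums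
    exp (- (LINT \<tau>:{s..t}|lborel. (lam * (1 - z)) powr \<alpha> \<tau>))"
  using expectation_nat_sums[OF measurable_X_increment[OF s], of "\<lambda>n. z ^ n" 1]
    expectation_power_X_increment[OF assms] z
  by (simp add: power_abs power_le_one mult.commute)

text \<open>The generating function at z = 0, where \<open>0 ^ 0 = 1\<close> leaves exactly the term
  n = 0.\<close>

lemma prob_X_increment_0:
  assumes "0 \<le> s" "s \<le> t"
  shows "prob {\<omega> \<in> space M. X t \<omega> - X s \<omega> = 0} = exp (- (LINT \<tau>:{s..t}|lborel. lam powr \<alpha> \<tau>))"
  using prob_X_increment_power_sums[OF assms, of 0] by simp

text \<open>Two power series of the generating function agree on the open unit disc, hence
  coefficient by coefficient; dropping the vanishing term r = 0 shifts the index to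
  \<open>Suc r\<close>.\<close>

lemma prob_X_increment_sums:
  assumes "0 \<le> \<tau>" "0 \<le> t" "1 \<le> n"
  shows "(\<lambda>r. transition_term lam \<alpha> \<tau> t n (Suc r)) sums
    prob {\<omega> \<in> space M. X (\<tau> + t) \<omega> - X \<tau> \<omega> = n}"
proof -
  have "prob {\<omega> \<in> space M. X (\<tau> + t) \<omega> - X \<tau> \<omega> = n} = (\<Sum>r. transition_term lam \<alpha> \<tau> t n r)"
  proof (rule powser_sums_unique[where s=1])
    fix z :: real assume z: "\<bar>z\<bar> < 1"
    show "(\<lambda>n. prob {\<omega> \<in> space M. X (\<tau> + t) \<omega> - X \<tau> \<omega> = n} * z ^ n) sums
        exp (- (LINT s:{\<tau>..\<tau> + t}|lborel. (lam * (1 - z)) powr \<alpha> s))"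
      using assms z by (intro prob_X_increment_power_sums) auto
    show "(\<lambda>n. (\<Sum>r. transition_term lam \<alpha> \<tau> t n r) * z ^ n) sums
        exp (- (LINT s:{\<tau>..\<tau> + t}|lborel. (lam * (1 - z)) powr \<alpha> s))"
      using assms z by (intro transition_series) auto
  qed simp
  then have "(\<lambda>r. transition_term lam \<alpha> \<tau> t n r) sums prob {\<omega> \<in> space M. X (\<tau> + t) \<omega> - X \<tau> \<omega> = n}"
    using transition_series(1)[OF assms(2), of 0 \<tau> n] by (simp add: sums_iff)
  then show ?thesis
    using transition_term_0[OF assms(3)] by (simp add: sums_Suc_iff)
qed

text \<open>A deviation above \<epsilon> forces a nonzero increment between the two times, whichever
  comes first. Its probability is 1 - exp (- I) \<le> I, where I integrates
  \<open>lam powr \<alpha> \<tau>\<close> between them, so it is at most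
  \<open>max 1 lam * \<bar>s - t\<bar>\<close>.\<close>

lemma stochastically_continuous_X: "stochastically_continuous M (\<lambda>t \<omega>. real (X t \<omega>))"
  unfolding stochastically_continuous_def
proof (intro allI impI)
  fix t \<epsilon> :: real assume t: "0 \<le> t" and \<epsilon>: "0 < \<epsilon>"
  let ?p = "\<lambda>s. prob {\<omega> \<in> space M. \<epsilon> < \<bar>real (X s \<omega>) - real (X t \<omega>)\<bar>}"
  have le: "?p s \<le> max 1 lam * \<bar>s - t\<bar>" if s: "0 \<le> s" for s
  proof -
    define x y where "x = min s t" and "y = max s t"
    have xy: "0 \<le> x" "x \<le> y" "y - x = \<bar>s - t\<bar>" using s t by (auto simp: x_def y_def)
    have E: "{\<omega> \<in> space M. X y \<omega> - X x \<omega> = 0} \<in> events"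
      using measurable_X_increment[OF xy(1,2)] by measurable
    have "?p s \<le> prob (space M - {\<omega> \<in> space M. X y \<omega> - X x \<omega> = 0})"
    proof (rule finite_measure_mono)
      show "{\<omega> \<in> space M. \<epsilon> < \<bar>real (X s \<omega>) - real (X t \<omega>)\<bar>} \<subseteq> space M - {\<omega> \<in> space M. X y \<omega> - X x \<omega> = 0}"
      proof
        fix \<omega> assume "\<omega> \<in> {\<omega> \<in> space M. \<epsilon> < \<bar>real (X s \<omega>) - real (X t \<omega>)\<bar>}"
        then have \<omega>: "\<omega> \<in> space M" and ne: "X s \<omega> \<noteq> X t \<omega>" using \<epsilon> by auto
        have "X x \<omega> \<le> X y \<omega>" using \<omega> xy by (intro X_mono)
        moreover have "X x \<omega> \<noteq> X y \<omega>" using ne by (auto simp: x_def y_def min_def max_def)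
        ultimately show "\<omega> \<in> space M - {\<omega> \<in> space M. X y \<omega> - X x \<omega> = 0}" using \<omega> by auto
      qed
    qed (use E in auto)
    also have "\<dots> = 1 - exp (- (LINT \<tau>:{x..y}|lborel. lam powr \<alpha> \<tau>))"
      using E prob_X_increment_0[OF xy(1,2)] by (simp add: prob_compl)
    also have "\<dots> \<le> (LINT \<tau>:{x..y}|lborel. lam powr \<alpha> \<tau>)"
      using exp_ge_add_one_self[of "- (LINT \<tau>:{x..y}|lborel. lam powr \<alpha> \<tau>)"] by simp
    also have "\<dots> \<le> max 1 lam * (y - x)"
      using lam_pos xy by (intro set_integral_powr_index_le) auto
    finally show ?thesis unfolding xy .
  qed
  show "(?p \<longlongrightarrow> 0) (at t within {0..})"
  proof (rule tendsto_sandwich[where f="\<lambda>_. 0"])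
    have "((\<lambda>s. max 1 lam * \<bar>s - t\<bar>) \<longlongrightarrow> max 1 lam * \<bar>t - t\<bar>) (at t within {0..})"
      by (intro tendsto_intros)
    then show "((\<lambda>s. max 1 lam * \<bar>s - t\<bar>) \<longlongrightarrow> 0) (at t within {0..})" by simp
    show "\<forall>\<^sub>F s in at t within {0..}. ?p s \<le> max 1 lam * \<bar>s - t\<bar>"
      using le by (auto simp: eventually_at_filter)
  qed auto
qed

lemma additive_process_X: "additive_process M (\<lambda>t \<omega>. real (X t \<omega>))"
  unfolding additive_process_def
proof (intro conjI allI impI ballI)
  fix t :: real assume "0 \<le> t"
  then have [measurable]: "X t \<in> M \<rightarrow>\<^sub>M count_space UNIV" by (rule measurable_X)
  show "(\<lambda>\<omega>. real (X t \<omega>)) \<in> borel_measurable M" by measurable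
qed (simp_all add: prob_space_axioms X_0 indep_increments_X stochastically_continuous_X cadlag_X)

end

theorem theorem3p1:
  fixes M :: "'a measure"
    and N :: "real \<Rightarrow> 'a \<Rightarrow> nat"
    and H :: "real \<Rightarrow> 'a \<Rightarrow> real"
    and \<alpha> :: "real \<Rightarrow> real"
    and lam :: real
  assumes "prob_space M"
    and "lam > 0"
    and "\<alpha> \<in> borel_measurable (restrict_space borel {0..})"
    and "\<forall>t\<ge>0. 0 < \<alpha> t \<and> \<alpha> t < 1"
    and "Poisson_process M lam N"
    and "multistable_subordinator M \<alpha> H"
    and "indep_processes M (\<lambda>t \<omega>. real (N t \<omega>)) H"
  shows "nonhom_subordinator M (\<lambda>t \<omega>. real (subordinated N H t \<omega>)) (multifractional_Levy lam \<alpha>) \<and>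
    (\<forall>\<tau>\<ge>0. \<forall>t\<ge>0. \<forall>k::nat.
      measure M {\<omega> \<in> space M. subordinated N H \<tau> \<omega> = k} > 0 \<longrightarrow>
      (\<forall>n\<ge>1. (\<lambda>r. transition_term lam \<alpha> \<tau> t n (Suc r)) sums
         \<P>(\<omega> in M. subordinated N H (\<tau> + t) \<omega> = k + n \<bar> subordinated N H \<tau> \<omega> = k)) \<and>
      \<P>(\<omega> in M. subordinated N H (\<tau> + t) \<omega> = k \<bar> subordinated N H \<tau> \<omega> = k) =
         exp (- (LINT s:{\<tau>..\<tau> + t}|lborel. lam powr \<alpha> s)))"
proof -
  interpret prob_space M by fact
  \<comment> \<open>\<alpha> is constrained on \<open>{0..}\<close> only, while the locale asks for
    bounds on the whole line; 1 / 2 is an arbitrary value in (0, 1). All time integrals run over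
    nonnegative times, where \<open>a\<close> and \<alpha> coincide.\<close>
  define a where "a s = (if 0 \<le> s then \<alpha> s else 1 / 2)" for s
  have a_eq: "a s = \<alpha> s" if "0 \<le> s" for s using that by (simp add: a_def)
  have "(\<lambda>s. indicator {0..} s *\<^sub>R \<alpha> s) \<in> borel_measurable borel"
    using assms(3) by (subst (asm) borel_measurable_restrict_space_iff) auto
  then have "(\<lambda>s. if 0 \<le> s then indicator {0..} s *\<^sub>R \<alpha> s else 1 / 2) \<in> borel_measurable borel"
    by measurable
  also have "(\<lambda>s. if 0 \<le> s then indicator {0..} s *\<^sub>R \<alpha> s else 1 / 2) = a"
    by (auto simp: a_def)
  finally have a_meas: "a \<in> borel_measurable borel" .
  have set_int_eq: "(LINT \<tau>:{s..t}|lborel. f \<tau>) = (LINT \<tau>:{s..t}|lborel. g \<tau>)"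
    if "0 \<le> s" "\<And>\<tau>. 0 \<le> \<tau> \<Longrightarrow> f \<tau> = g \<tau>" for s t and f g :: "real \<Rightarrow> real"
    using that by (intro set_lebesgue_integral_cong) auto
  have Hsub: "nonhom_subordinator M H (multistable_Levy \<alpha>)"
    using assms(6) by (simp add: multistable_subordinator_def)
  interpret multifractional_poisson M N H lam a
  proof unfold_locales
    show "0 < lam" "Poisson_process M lam N" "indep_processes M (\<lambda>t \<omega>. real (N t \<omega>)) H"
      "a \<in> borel_measurable borel" by fact+
    show "additive_process M H" using Hsub by (simp add: nonhom_subordinator_def)
    show "mono_on {0..} (\<lambda>t. H t \<omega>)" if "\<omega> \<in> space M" for \<omega>
      using Hsub that by (simp add: nonhom_subordinator_def)
    show "0 < a s \<and> a s < 1" for s using assms(4) by (simp add: a_def)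
    fix u s t :: real assume "0 \<le> u" "0 \<le> s" "s \<le> t"
    then have "(\<integral>\<omega>. exp (- u * (H t \<omega> - H s \<omega>)) \<partial>M) =
        exp (- (LINT \<tau>:{s..t}|lborel. Bernstein_fun (multistable_Levy \<alpha>) u \<tau>))"
      using Hsub unfolding nonhom_subordinator_def by blast
    also have "(LINT \<tau>:{s..t}|lborel. Bernstein_fun (multistable_Levy \<alpha>) u \<tau>) =
        (LINT \<tau>:{s..t}|lborel. u powr a \<tau>)"
      using \<open>0 \<le> u\<close> \<open>0 \<le> s\<close> assms(4)
      by (intro set_int_eq) (auto simp: a_eq Bernstein_fun_multistable_Levy)
    finally show "(\<integral>\<omega>. exp (- u * (H t \<omega> - H s \<omega>)) \<partial>M) =
        exp (- (LINT \<tau>:{s..t}|lborel. u powr a \<tau>))" .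
  qed
  have Bern: "Bernstein_fun (multifractional_Levy lam \<alpha>) u \<tau> = (lam * (1 - exp (- u))) powr a \<tau>"
    if "0 \<le> u" "0 \<le> \<tau>" for u \<tau>
    using that assms(2,4) by (simp add: a_eq Bernstein_fun_multifractional_Levy)
  have "nonhom_subordinator M (\<lambda>t \<omega>. real (X t \<omega>)) (multifractional_Levy lam \<alpha>)"
    unfolding nonhom_subordinator_def
  proof (intro conjI allI ballI impI)
    show "additive_process M (\<lambda>t \<omega>. real (X t \<omega>))" by (rule additive_process_X)
    show "mono_on {0..} (\<lambda>t. real (X t \<omega>))" if "\<omega> \<in> space M" for \<omega>
      using X_mono[OF that] by (auto simp: monotone_on_def)
    show "pos_Levy_measure (multifractional_Levy lam \<alpha> t)" if "0 \<le> t" for t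
      using that assms(2,4) by (intro pos_Levy_measure_multifractional_Levy) auto
    fix u s t :: real assume u: "0 \<le> u" and s: "0 \<le> s" "s \<le> t"
    have "0 \<le> lam * (1 - exp (- u))" using assms(2) u by simp
    then have "set_integrable lborel {s..t} (\<lambda>\<tau>. (lam * (1 - exp (- u))) powr a \<tau>)"
      unfolding set_integrable_def real_scaleR_def by (rule integrable_powr_index)
    also have "?this \<longleftrightarrow> set_integrable lborel {s..t} (Bernstein_fun (multifractional_Levy lam \<alpha>) u)"
      using u s by (intro set_integrable_cong refl) (simp add: Bern)
    finally show "set_integrable lborel {s..t} (Bernstein_fun (multifractional_Levy lam \<alpha>) u)" .
    \<comment> \<open>The Laplace transform is the generating function at z =
      \<open>exp (- u)\<close>; u = 0 gives the boundary point z = 1, which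
      \<open>expectation_power_X_increment\<close> admits.\<close>
    have "(\<integral>\<omega>. exp (- u * (real (X t \<omega>) - real (X s \<omega>))) \<partial>M) = (\<integral>\<omega>. exp (- u) ^ (X t \<omega> - X s \<omega>) \<partial>M)"
      using s X_mono by (intro Bochner_Integration.integral_cong refl)
        (simp add: exp_of_nat_mult[symmetric] of_nat_diff mult.commute)
    also have "\<dots> = exp (- (LINT \<tau>:{s..t}|lborel. (lam * (1 - exp (- u))) powr a \<tau>))"
      using u s by (intro expectation_power_X_increment) auto
    also have "(LINT \<tau>:{s..t}|lborel. (lam * (1 - exp (- u))) powr a \<tau>) =
        (LINT \<tau>:{s..t}|lborel. Bernstein_fun (multifractional_Levy lam \<alpha>) u \<tau>)"
      using u s by (intro set_int_eq) (auto simp: Bern)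
    finally show "(\<integral>\<omega>. exp (- u * (real (X t \<omega>) - real (X s \<omega>))) \<partial>M) =
        exp (- (LINT \<tau>:{s..t}|lborel. Bernstein_fun (multifractional_Levy lam \<alpha>) u \<tau>))" .
  qed
  moreover have "(\<forall>n\<ge>1. (\<lambda>r. transition_term lam \<alpha> \<tau> t n (Suc r)) sums
         \<P>(\<omega> in M. X (\<tau> + t) \<omega> = k + n \<bar> X \<tau> \<omega> = k)) \<and>
      \<P>(\<omega> in M. X (\<tau> + t) \<omega> = k \<bar> X \<tau> \<omega> = k) =
         exp (- (LINT s:{\<tau>..\<tau> + t}|lborel. lam powr \<alpha> s))"
    if \<tau>: "0 \<le> \<tau>" and t: "0 \<le> t" and pos: "0 < measure M {\<omega> \<in> space M. X \<tau> \<omega> = k}" for \<tau> t k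
  proof -
    \<comment> \<open>The joint probability factorises, and the positive probability of the
      conditioning event cancels.\<close>
    have cond: "\<P>(\<omega> in M. X (\<tau> + t) \<omega> = k + n \<bar> X \<tau> \<omega> = k) =
        prob {\<omega> \<in> space M. X (\<tau> + t) \<omega> - X \<tau> \<omega> = n}" for n
      unfolding cond_prob_def prob_X_increment[OF \<tau> t] using pos by simp
    have "transition_term lam \<alpha> \<tau> t n r = transition_term lam a \<tau> t n r" for n r
    proof -
      have b: "\<beta> \<alpha> r s = \<beta> a r s" if "s \<in> PiE {1..r} (\<lambda>_. {\<tau>..\<tau> + t})" for s
        unfolding \<beta>_def
      proof (intro sum.cong refl)
        fix j assume "j \<in> {1..r}"
        then have "s j \<in> {\<tau>..\<tau> + t}" using that by blast
        then show "\<alpha> (s j) = a (s j)" using \<tau> by (simp add: a_eq)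
      qed
      show ?thesis
        unfolding transition_term_def set_lebesgue_integral_def
        by (intro arg_cong2[where f="(*)"] Bochner_Integration.integral_cong refl)
          (auto simp: b indicator_def)
    qed
    moreover have "(LINT s:{\<tau>..\<tau> + t}|lborel. lam powr \<alpha> s) = (LINT s:{\<tau>..\<tau> + t}|lborel. lam powr a s)"
      using \<tau> by (intro set_int_eq) (auto simp: a_eq)
    ultimately show ?thesis
      using prob_X_increment_sums[OF \<tau> t] prob_X_increment_0[OF \<tau>, of "\<tau> + t"] cond cond[of 0] t
      by simp
  qed
  ultimately show ?thesis by blast
qed

end
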